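(* Let $\gamma\in(0,1)$, $C>0$, $\bar w\ge 0$, $\sigma\in(0,1)$ and let $\tau\ge 1$ be an integer. Consider the asynchronous stochastic approximation iterates $x(t)$ described in the context, and suppose: (1) $\|F(x)-F(y)\|_v\le\gamma\|x-y\|_v$ for all $x,y\in\mathbb{R}^{\mathcal N}$, and $\|F(x)\|_v\le\gamma\|x\|_v+C$ for all $x\in\mathbb{R}^{\mathcal N}$; let $x^*$ denote the unique fixed point of $F$. (2) For every $t\ge 0$, $w(t)$ is $\mathcal F_{t+1}$-measurable, $\mathbb E[w(t)\mid\mathcal F_t]=0$, and $|w(t)|\le\bar w$ almost surely. (3) For every $i\in\mathcal N$ and every $t\ge\tau$, $\mathbb P(i_t=i\mid\mathcal F_{t-\tau})\ge\sigma$ almost surely. (4) There is a constant $\bar x\ge\|x^*\|_v$ such that $\|x(t)\|_v\le\bar x$ almost surely for all $t$. Let the step size be $\alpha_t=\frac{h}{t+t_0}$ with $t_0\ge\max(4h,\tau)$ and $h\ge\frac{2}{\sigma(1-\gamma)}$, and set $\bar\epsilon=2\bar x+C+\frac{\bar w}{\underline v}$. Then for every integer $T\ge 1$ and every $\delta\in(0,1)$, with probability at least $1-\delta$, $$\|x(T)-x^*\|_v\le\frac{12\bar\epsilon}{1-\gamma}\sqrt{\frac{(\tau+1)h}{\sigma}}\sqrt{\frac{\log\left(\frac{2(\tau+1)T^2n}{\delta}\right)}{T+t_0}}+\frac{4}{1-\gamma}\max\left(\frac{16\bar\epsilon h\tau}{\sigma},\,2\bar x(\tau+t_0)\right)\f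rac{1}{T+t_0}.$$
   Context: Let $\mathcal N=\{1,\dots,n\}$ with $n\ge1$, and fix a vector $v=(v_1,\dots,v_n)$ with all $v_i>0$. The weighted infinity norm on $\mathbb R^{\mathcal N}$ is $\|x\|_v=\sup_{i\in\mathcal N}|x_i|/v_i$, and $\underline v=\min_{i\in\mathcal N}v_i$. Let $F:\mathbb R^{\mathcal N}\to\mathbb R^{\mathcal N}$ be a (deterministic) operator with $i$-th component $F_i$. On a probability space with filtration $(\mathcal F_t)_{t\ge0}$, let $(i_t)_{t\ge0}$ be an $\mathcal N$-valued stochastic process adapted to $(\mathcal F_t)$, let $(w(t))_{t\ge0}$ be real-valued random variables, and let $(\alpha_t)_{t\ge 0}$ be deterministic step sizes. The iterates $x(t)\in\mathbb R^{\mathcal N}$ are defined by $x(0)=0$ and $$x_i(t+1)=x_i(t)+\alpha_t\big(F_i(x(t))-x_i(t)+w(t)\big)\ \text{ for } i=i_t,\qquad x_i(t+1)=x_i(t)\ \text{ for } i\ne i_t.$$ *)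

theory Defs
  imports "HOL-Probability.Probability"
begin

definition weighted_infnorm :: "real ^ 'n \<Rightarrow> real ^ 'n \<Rightarrow> real" where
  "weighted_infnorm v x = (SUP i. \<bar>x $ i\<bar> / v $ i)"

text \<open>
  Pathwise asynchronous stochastic approximation: \<open>i t \<omega>\<close> is the single component updated at
  time \<open>t\<close>, and \<open>w t \<omega>\<close> is the scalar noise entering that update.
\<close>

primrec async_sa ::
  "(real ^ 'n \<Rightarrow> real ^ 'n) \<Rightarrow> (nat \<Rightarrow> real) \<Rightarrow> (nat \<Rightarrow> 'a \<Rightarrow> 'n) \<Rightarrow> (nat \<Rightarrow> 'a \<Rightarrow> real)
    \<Rightarrow> nat \<Rightarrow> 'a \<Rightarrow> real ^ 'n"
where
  "async_sa F \<alpha> i w 0 \<omega> = 0"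
| "async_sa F \<alpha> i w (Suc t) \<omega> =
    (let x = async_sa F \<alpha> i w t \<omega>
     in \<chi> j. if j = i t \<omega> then x $ j + \<alpha> t * (F x $ j - x $ j + w t \<omega>) else x $ j)"

end

theory Submission
  imports Defs
begin

text \<open>
  Fix a component \<open>j\<close>, let \<open>D t\<close> be the conditional probability that \<open>j\<close> is updated at time
  \<open>t\<close> given the history up to \<open>t - \<tau>\<close>, and replace the update indicator by \<open>D t\<close>. The
  scaled error then obeys a recursion with damping \<open>1 - \<alpha> t * D t\<close>, contracting drift
  \<open>\<alpha> t * D t * \<gamma>\<close>, a lag error of order \<open>\<tau> * \<alpha> t\<close>, and an innovation that is centred
  given the history up to \<open>t - \<tau>\<close>. Subtracting the damped sum of the innovations leaves a
  deterministic recursion, along which a bound \<open>P / sqrt s + Q / s\<close> with \<open>s = t + t0\<close>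
  propagates.

  The damping is random and depends on the same past as the innovations, so the damped sum is
  not a martingale transform. It is split into \<open>\<tau> + 1\<close> sums, one per residue class of time.
  In each class \<open>cosh (l * noise)\<close> serves as a Lyapunov function: as \<open>cosh\<close> increases in the
  absolute value of its argument, random damping may be replaced by the worst case \<open>\<sigma>\<close>, and a
  centred innovation of size at most \<open>c\<close> costs a factor \<open>cosh (l * \<alpha> t * c)\<close>. Markov's
  inequality and a union bound over classes, components and times conclude.
\<close>

subsection \<open>Damped sums and scalar inequalities\<close>

text \<open>In closed form, the sum over \<open>k < t\<close> of \<open>b k\<close> times the
  product of \<open>1 - a l\<close> over \<open>k < l < t\<close>. The recursion makes each estimate
  a plain induction on time.\<close>

primrec damped :: "(nat \<Rightarrow> real) \<Rightarrow> (nat \<Rightarrow> real) \<Rightarrow> nat \<Rightarrow> real" where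
  "damped a b 0 = 0"
| "damped a b (Suc t) = (1 - a t) * damped a b t + b t"

lemma damped_sum: "(\<Sum>r\<in>R. damped a (b r) t) = damped a (\<lambda>k. \<Sum>r\<in>R. b r k) t"
  by (induction t) (simp_all add: sum.distrib flip: sum_distrib_left)

text \<open>Linearity in \<open>b\<close>, since each time lies in exactly one residue class. It
  serves both to split the noise and to add up the proxy variances of the classes.\<close>

lemma damped_residues:
  "(\<Sum>r\<le>m. damped a (\<lambda>k. if k mod Suc m = r then b k else 0) t) = damped a b t"
proof -
  have "(\<Sum>r\<le>m. if k mod Suc m = r then b k else 0) = b k" for k
    using mod_less_divisor[of "Suc m" k] by (subst sum.delta') (auto simp: less_Suc_eq_le)
  then show ?thesis
    by (simp add: damped_sum)
qed

lemma damped_nonneg: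
  assumes "\<And>k. a k \<le> 1" "\<And>k. b k \<ge> 0"
  shows "damped a b t \<ge> 0"
  using assms by (induction t) auto

text \<open>With \<open>s = t + t0\<close>, damping the bound and adding the new squared step yields
  the old bound minus \<open>h\<^sup>2 / s\<^sup>2\<close>. The bound itself only has to fall by
  \<open>2 * h / (\<sigma> * (s * (s + 1)))\<close>, which is no larger because
  \<open>2 \<le> h * \<sigma>\<close>.\<close>

lemma damped_square_steps_le:
  fixes h \<sigma> t0 :: real
  assumes "0 < \<sigma>" "2 \<le> h * \<sigma>" "h * \<sigma> \<le> t0"
  shows "damped (\<lambda>k. h / (real k + t0) * \<sigma>) (\<lambda>k. (h / (real k + t0))\<^sup>2) t
    \<le> 2 * h / (\<sigma> * (real t + t0))"
proof (induction t)
  case 0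
  have "0 < t0" "0 < h"
    using assms zero_less_mult_pos2[of h \<sigma>] by linarith+
  then show ?case using assms by simp
next
  case (Suc t)
  define s where "s = real t + t0"
  have s: "0 < s" "h * \<sigma> \<le> s" using assms by (auto simp: s_def)
  have h: "0 < h" using assms zero_less_mult_pos2[of h \<sigma>] by linarith
  have "(1 - h / s * \<sigma>) * damped (\<lambda>k. h / (real k + t0) * \<sigma>) (\<lambda>k. (h / (real k + t0))\<^sup>2) t + (h / s)\<^sup>2
      \<le> (1 - h / s * \<sigma>) * (2 * h / (\<sigma> * s)) + (h / s)\<^sup>2"
    using Suc s by (intro add_right_mono mult_left_mono) (auto simp: s_def)
  also have "\<dots> = 2 * h / (\<sigma> * s) - h\<^sup>2 / s\<^sup>2"
    using s assms(1) by (simp add: field_simps power2_eq_square)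
  also have "\<dots> \<le> 2 * h / (\<sigma> * s) - 2 * h / (\<sigma> * (s * (s + 1)))"
  proof (rule diff_left_mono)
    have "2 * h / (\<sigma> * (s * (s + 1))) \<le> (h * \<sigma>) * h / (\<sigma> * (s * s))"
      using s h assms by (intro frac_le mult_mono) auto
    also have "\<dots> = h\<^sup>2 / s\<^sup>2"
      using assms(1) by (simp add: power2_eq_square)
    finally show "2 * h / (\<sigma> * (s * (s + 1))) \<le> h\<^sup>2 / s\<^sup>2" .
  qed
  also have "\<dots> = 2 * h / \<sigma> * (1 / s - 1 / (s * (s + 1)))"
    by (simp add: right_diff_distrib)
  also have "1 / s - 1 / (s * (s + 1)) = 1 / (s + 1)"
    using s by (simp add: divide_simps)
  finally show ?case by (simp add: s_def add_ac)
qed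

lemma inverse_sqrt_diff_le:
  assumes "0 < s"
  shows "1 / sqrt s - 1 / sqrt (s + 1) \<le> 1 / (2 * (s * sqrt s))"
proof -
  have "(sqrt (s + 1) - sqrt s) * (sqrt (s + 1) + sqrt s) = 1"
    using assms by (simp add: algebra_simps)
  then have "sqrt (s + 1) - sqrt s = 1 / (sqrt (s + 1) + sqrt s)"
    using assms by (simp add: eq_divide_eq add_pos_pos less_imp_neq[symmetric])
  also have "\<dots> \<le> 1 / (2 * sqrt s)"
    using assms by (intro divide_left_mono) (auto intro!: add_pos_pos mult_pos_pos)
  finally have *: "sqrt (s + 1) - sqrt s \<le> 1 / (2 * sqrt s)" .
  have "1 / sqrt s - 1 / sqrt (s + 1) = (sqrt (s + 1) - sqrt s) / (sqrt s * sqrt (s + 1))"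
    using assms by (simp add: field_simps)
  also have "\<dots> \<le> (1 / (2 * sqrt s)) / (sqrt s * sqrt s)"
    using assms * by (intro frac_le mult_left_mono mult_pos_pos) auto
  also have "\<dots> = 1 / (2 * (s * sqrt s))"
    using assms by simp
  finally show ?thesis .
qed

text \<open>Here \<open>u0\<close> is a component of the error without noise, \<open>a0\<close> the
  full error, \<open>A - P\<close> the noise coefficient and \<open>\<phi>\<close> the lag error.
  The bound on \<open>A - P\<close> gives
  \<open>P - \<gamma> * A \<ge> (1 - \<gamma>) / 4 * P\<close>, so the damping gains at least
  \<open>P / 2\<close>, which pays for the decay of \<open>1 / sqrt s\<close>. Of the contraction of
  \<open>Q\<close>, one half absorbs \<open>\<phi>\<close> and the other pays for the decay of
  \<open>1 / s\<close>.\<close>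

lemma decay_step:
  fixes h s d \<gamma> \<sigma> P A Q u u0 a0 \<phi> :: real
  assumes s: "0 < s" "h * d \<le> s" and d: "\<sigma> \<le> d" and h: "0 < h" and \<gamma>: "0 < \<gamma>" "\<gamma> < 1" and \<sigma>: "0 < \<sigma>"
    and h\<sigma>: "2 \<le> h * \<sigma> * (1 - \<gamma>)"
    and PA: "0 \<le> A" "P \<le> A" "A - P \<le> 3 / 4 * (1 - \<gamma>) * A" and Q: "0 \<le> Q"
    and u0: "u0 \<le> P / sqrt s + Q / s" and a0: "a0 \<le> A / sqrt s + Q / s"
    and \<phi>: "\<phi> \<le> \<sigma> * (1 - \<gamma>) * Q / (2 * s)"
    and u: "u \<le> (1 - h / s * d) * u0 + h / s * d * (\<gamma> * a0) + h / s * \<phi>"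
  shows "u \<le> P / sqrt (s + 1) + Q / (s + 1)"
proof -
  have "u \<le> (1 - h / s * d) * (P / sqrt s + Q / s) + h / s * d * (\<gamma> * (A / sqrt s + Q / s))
      + h / s * (\<sigma> * (1 - \<gamma>) * Q / (2 * s))"
    using s d h \<gamma> \<sigma>
    by (intro order_trans[OF u] add_mono mult_left_mono u0 a0 \<phi>) (auto simp: divide_le_eq)
  also have "\<dots> = P / sqrt s - h * d * (P - \<gamma> * A) / (s * sqrt s) + Q / s
      - h * d * (1 - \<gamma>) * Q / s\<^sup>2 + h * \<sigma> * (1 - \<gamma>) * Q / 2 / s\<^sup>2"
  proof -
    \<comment> \<open>The identity is polynomial in the two reciprocals; proving it for free
      \<open>p\<close> and \<open>q\<close> keeps the square root out of the algebra.\<close>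
    have "(1 - h * q * d) * (P * p + Q * q) + h * q * d * (\<gamma> * (A * p + Q * q))
        + h * q * (\<sigma> * (1 - \<gamma>) * Q * (q / 2))
      = P * p - h * d * (P - \<gamma> * A) * (q * p) + Q * q
        - h * d * (1 - \<gamma>) * Q * q\<^sup>2 + h * \<sigma> * (1 - \<gamma>) * Q / 2 * q\<^sup>2" for p q
      by (simp add: power2_eq_square field_simps)
    from this[of "1 / s" "1 / sqrt s"] show ?thesis
      by (simp add: power_divide mult.commute)
  qed
  also have "\<dots> \<le> P / sqrt (s + 1) + Q / (s + 1)"
  proof -
    have P: "0 \<le> P" and PgA: "(1 - \<gamma>) / 4 * P \<le> P - \<gamma> * A"
    proof -
      have "A * (1 - 3/4 * (1 - \<gamma>)) \<ge> 0" using PA \<gamma> by auto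
      then show "0 \<le> P" using PA by (simp add: algebra_simps)
      have "(1 - \<gamma>) / 4 * P \<le> (1 - \<gamma>) / 4 * A" using PA \<gamma> by (intro mult_left_mono) auto
      then show "(1 - \<gamma>) / 4 * P \<le> P - \<gamma> * A" using PA by (simp add: field_simps)
    qed
    have hd: "h * \<sigma> \<le> h * d" using h d by simp
    have "P / 2 \<le> h * \<sigma> * (1 - \<gamma>) * (P / 4)"
      using mult_right_mono[OF h\<sigma>, of "P / 4"] P by simp
    also have "\<dots> \<le> h * d * ((1 - \<gamma>) / 4 * P)"
      using mult_right_mono[OF hd, of "(1 - \<gamma>) / 4 * P"] P \<gamma> by simp
    also have "\<dots> \<le> h * d * (P - \<gamma> * A)"
      using h d \<sigma> PgA by (intro mult_left_mono) auto
    finally have "P / 2 / (s * sqrt s) \<le> h * d * (P - \<gamma> * A) / (s * sqrt s)"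
      using s by (intro divide_right_mono) auto
    moreover have "P / sqrt s - P / sqrt (s + 1) \<le> P / 2 / (s * sqrt s)"
      using mult_left_mono[OF inverse_sqrt_diff_le[OF s(1)] P] by (simp add: algebra_simps)
    ultimately have 1: "P / sqrt s - h * d * (P - \<gamma> * A) / (s * sqrt s) \<le> P / sqrt (s + 1)"
      by linarith
    have "Q \<le> h * \<sigma> * (1 - \<gamma>) * (Q / 2)"
      using mult_right_mono[OF h\<sigma>, of "Q / 2"] Q by simp
    moreover have "h * \<sigma> * ((1 - \<gamma>) * Q) \<le> h * d * ((1 - \<gamma>) * Q)"
      using mult_right_mono[OF hd, of "(1 - \<gamma>) * Q"] Q \<gamma> by simp
    ultimately have "Q \<le> h * d * (1 - \<gamma>) * Q - h * \<sigma> * (1 - \<gamma>) * Q / 2"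
      by simp
    then have "Q / s\<^sup>2 \<le> (h * d * (1 - \<gamma>) * Q - h * \<sigma> * (1 - \<gamma>) * Q / 2) / s\<^sup>2"
      by (intro divide_right_mono) auto
    moreover have "Q / s - Q / (s + 1) \<le> Q / s\<^sup>2"
    proof -
      have "Q / s - Q / (s + 1) = Q / (s * (s + 1))" using s by (simp add: field_simps)
      also have "\<dots> \<le> Q / (s * s)" using s Q by (intro divide_left_mono mult_left_mono) auto
      finally show ?thesis by (simp add: power2_eq_square)
    qed
    ultimately show ?thesis using 1 by (simp add: diff_divide_distrib)
  qed
  finally show ?thesis .
qed

text \<open>The symmetric two-point case of the estimate behind Hoeffding's lemma, with weight
  \<open>1/2\<close> and range \<open>2 * y\<close>; evenness of \<open>cosh\<close> covers negative
  arguments.\<close>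

lemma cosh_le_exp_half_square: "cosh x \<le> exp (x\<^sup>2 / 2)" for x :: real
proof -
  have "cosh y \<le> exp (y\<^sup>2 / 2)" if "0 \<le> y" for y :: real
  proof -
    have eq: "1 + 1/2 * (exp (2 * y) - 1) = exp y * cosh y"
      by (simp add: cosh_field_def field_simps flip: exp_add)
    have "- y + ln (exp y * cosh y) \<le> y\<^sup>2 / 2"
      using Hoeffdings_lemma_aux[of "2 * y" "1/2"] that unfolding eq by (simp add: power2_eq_square)
    then have "ln (cosh y) \<le> y\<^sup>2 / 2"
      by (simp add: ln_mult)
    then show ?thesis
      by (metis cosh_real_pos exp_le_cancel_iff exp_ln)
  qed
  from this[of "\<bar>x\<bar>"] show ?thesis by simp
qed

text \<open>By convexity the exponential lies below its chord over the interval from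
  \<open>- (p * c)\<close> to \<open>p * c\<close>; the weight of the right end is
  \<open>(c + y) / (2 * c)\<close>.\<close>

lemma exp_le_chord:
  fixes c p y :: real
  assumes "\<bar>y\<bar> \<le> c" "0 < c"
  shows "exp (p * y) \<le> cosh (p * c) + sinh (p * c) / c * y"
proof -
  have "exp ((1 - (c + y) / (2 * c)) *\<^sub>R (- (p * c)) + ((c + y) / (2 * c)) *\<^sub>R (p * c))
      \<le> (1 - (c + y) / (2 * c)) * exp (- (p * c)) + (c + y) / (2 * c) * exp (p * c)"
    using assms convex_on_exp[of 1] by (intro convex_onD[where A = UNIV and f = exp]) (auto simp: divide_le_eq)
  also have "(1 - (c + y) / (2 * c)) *\<^sub>R (- (p * c)) + ((c + y) / (2 * c)) *\<^sub>R (p * c) = p * y"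
    using assms by (simp add: field_simps)
  also have "(1 - (c + y) / (2 * c)) * exp (- (p * c)) + (c + y) / (2 * c) * exp (p * c)
     = cosh (p * c) + sinh (p * c) / c * y"
    using assms by (simp add: cosh_field_def sinh_field_def field_simps)
  finally show ?thesis .
qed

text \<open>The chord bound is applied to both exponentials in \<open>cosh\<close>. The remainder is
  linear in \<open>y\<close>, so it vanishes in expectation when \<open>y\<close> is centred given
  \<open>A\<close>, and only the factor \<open>cosh (p * c)\<close> survives.\<close>

lemma cosh_add_le_chord:
  fixes A c p y :: real
  assumes "\<bar>y\<bar> \<le> c" "0 < c"
  shows "cosh (A + p * y) \<le> cosh A * cosh (p * c) + sinh (p * c) / c * (y * sinh A)"
proof -
  have "cosh (A + p * y) = exp A / 2 * exp (p * y) + exp (- A) / 2 * exp (p * (- y))"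
    by (simp add: cosh_field_def exp_add exp_diff exp_minus field_simps)
  also have "\<dots> \<le> exp A / 2 * (cosh (p * c) + sinh (p * c) / c * y)
      + exp (- A) / 2 * (cosh (p * c) + sinh (p * c) / c * (- y))"
    using assms by (intro add_mono mult_left_mono exp_le_chord) auto
  also have "\<dots> = (exp A + exp (- A)) / 2 * cosh (p * c) + sinh (p * c) / c * (y * ((exp A - exp (- A)) / 2))"
    by (simp add: algebra_simps diff_divide_distrib add_divide_distrib)
  finally show ?thesis by (simp add: cosh_field_def sinh_field_def)
qed

subsection \<open>Concentration of damped sums of lagged innovations\<close>

text \<open>The setting of one component: \<open>d\<close> plays the conditional update probability
  and \<open>e\<close> the innovation. Conditional centring is stated as orthogonality to bounded
  functions of the lagged past, which keeps conditional expectations out of the concentration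
  argument.\<close>

locale lagged_noise = prob_space M for M :: "'a measure" +
  fixes Fil :: "nat \<Rightarrow> 'a measure" and d e :: "nat \<Rightarrow> 'a \<Rightarrow> real"
    and \<alpha> :: "nat \<Rightarrow> real" and \<sigma> c :: real and \<tau> :: nat
  assumes subalg: "subalgebra M (Fil t)"
    and Fil_mono: "s \<le> t \<Longrightarrow> sets (Fil s) \<subseteq> sets (Fil t)"
    and \<alpha>: "0 \<le> \<alpha> t" "\<alpha> t \<le> 1"
    and \<sigma>: "0 \<le> \<sigma>"
    and c: "0 < c"
    and d_meas: "d t \<in> borel_measurable (Fil (t - \<tau>))"
    and d_bounds: "\<sigma> \<le> d t \<omega>" "d t \<omega> \<le> 1"
    and e_meas: "e t \<in> borel_measurable (Fil (Suc t))"
    and e_bound: "AE \<omega> in M. \<bar>e t \<omega>\<bar> \<le> c"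
    and e_orth: "\<lbrakk>Z \<in> borel_measurable (Fil (t - \<tau>)); AE \<omega> in M. \<bar>Z \<omega>\<bar> \<le> b\<rbrakk>
      \<Longrightarrow> expectation (\<lambda>\<omega>. e t \<omega> * Z \<omega>) = 0"
begin

text \<open>Only the innovations are restricted to the class \<open>r\<close>; the damping acts at
  every time.\<close>

definition noise :: "nat \<Rightarrow> nat \<Rightarrow> 'a \<Rightarrow> real" where
  "noise r t \<omega> = damped (\<lambda>k. \<alpha> k * d k \<omega>) (\<lambda>k. if k mod Suc \<tau> = r then \<alpha> k * e k \<omega> else 0) t"

text \<open>Up to the factor \<open>c\<^sup>2\<close>, a sub-Gaussian variance proxy for
  \<open>noise r t\<close>. The damping enters to the first power instead of squared, so that the
  classes add up to the sum bounded in \<open>damped_square_steps_le\<close>.\<close>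

definition proxy_var :: "nat \<Rightarrow> nat \<Rightarrow> real" where
  "proxy_var r t = damped (\<lambda>k. \<alpha> k * \<sigma>) (\<lambda>k. if k mod Suc \<tau> = r then (\<alpha> k)\<^sup>2 else 0) t"

lemma \<sigma>_le_1: "\<sigma> \<le> 1"
  using d_bounds[of 0] order_trans by blast

lemma proxy_var_nonneg: "0 \<le> proxy_var r t"
  unfolding proxy_var_def using \<alpha> \<sigma> \<sigma>_le_1 by (intro damped_nonneg) (auto intro: mult_le_one)

lemma space_Fil: "space (Fil t) = space M"
  using subalg by (simp add: subalgebra_def)

lemma borel_measurable_Fil_mono:
  assumes "s \<le> t" "f \<in> borel_measurable (Fil s)"
  shows "f \<in> borel_measurable (Fil t)"
  using assms measurable_mono[OF order_refl refl Fil_mono, of s t borel] by (auto simp: space_Fil)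

text \<open>The hypotheses match the two sources of randomness: an innovation at time
  \<open>k\<close> is known at \<open>Suc k\<close>, a damping factor at time \<open>k\<close>
  already at \<open>k - \<tau>\<close>.\<close>

lemma noise_measurable_Fil:
  assumes "\<And>k. k < t \<Longrightarrow> k mod Suc \<tau> = r \<Longrightarrow> k < s" "t \<le> Suc (s + \<tau>)"
  shows "noise r t \<in> borel_measurable (Fil s)"
  using assms
proof (induction t)
  case 0
  then show ?case by (simp add: noise_def)
next
  case (Suc t)
  have IH: "noise r t \<in> borel_measurable (Fil s)"
    using Suc.prems by (intro Suc.IH) auto
  have d: "d t \<in> borel_measurable (Fil s)"
    using Suc.prems by (intro borel_measurable_Fil_mono[OF _ d_meas]) auto
  have e: "e t \<in> borel_measurable (Fil s)" if "t mod Suc \<tau> = r"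
    using Suc.prems(1)[of t] that by (intro borel_measurable_Fil_mono[OF _ e_meas]) auto
  have eq: "noise r (Suc t) =
      (\<lambda>\<omega>. (1 - \<alpha> t * d t \<omega>) * noise r t \<omega> + (if t mod Suc \<tau> = r then \<alpha> t * e t \<omega> else 0))"
    by (simp add: noise_def fun_eq_iff)
  show ?case
    unfolding eq using IH d e by (cases "t mod Suc \<tau> = r") simp_all
qed

text \<open>Within a residue class modulo \<open>\<tau> + 1\<close> consecutive innovations are far enough apart
  that the past noise, including the random damping factors, is already known at the time
  to which the next innovation is conditionally centred.\<close>

lemma noise_measurable_lag:
  assumes "t mod Suc \<tau> = r"
  shows "noise r t \<in> borel_measurable (Fil (t - \<tau>))"
proof (rule noise_measurable_Fil)
  fix k assume k: "k < t" "k mod Suc \<tau> = r"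
  have "Suc \<tau> dvd t - k"
    using assms k mod_eq_dvd_iff_nat[of k t "Suc \<tau>"] by auto
  then have "Suc \<tau> \<le> t - k"
    using k by (intro dvd_imp_le) auto
  then show "k < t - \<tau>" by linarith
qed simp

lemma noise_measurable [measurable]: "noise r t \<in> borel_measurable M"
  by (rule measurable_from_subalg[OF subalg noise_measurable_Fil[where s = t]]) auto

lemma e_measurable [measurable]: "e t \<in> borel_measurable M"
  by (rule measurable_from_subalg[OF subalg e_meas])

lemma d_measurable [measurable]: "d t \<in> borel_measurable M"
  by (rule measurable_from_subalg[OF subalg d_meas])

lemma total_noise_measurable [measurable]:
  "(\<lambda>\<omega>. damped (\<lambda>k. \<alpha> k * d k \<omega>) (\<lambda>k. \<alpha> k * e k \<omega>) t) \<in> borel_measurable M"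
  by (induction t) simp_all

lemma damping_bounds: "0 \<le> 1 - \<alpha> t * d t \<omega>" "1 - \<alpha> t * d t \<omega> \<le> 1 - \<alpha> t * \<sigma>"
  using \<alpha>[of t] d_bounds[of t \<omega>] \<sigma> mult_left_mono[of \<sigma> "d t \<omega>" "\<alpha> t"] mult_le_one[of "\<alpha> t" "d t \<omega>"]
  by auto

text \<open>A crude bound that makes the \<open>cosh\<close> moments integrable and the
  \<open>sinh\<close> test functions bounded.\<close>

lemma noise_AE_bounded: "AE \<omega> in M. \<bar>noise r t \<omega>\<bar> \<le> c * real t"
proof (induction t)
  case 0
  then show ?case by (simp add: noise_def)
next
  case (Suc t)
  show ?case
    using Suc e_bound[of t]
  proof eventually_elim
    case (elim \<omega>)
    have "\<bar>noise r (Suc t) \<omega>\<bar> \<le> \<bar>1 - \<alpha> t * d t \<omega>\<bar> * \<bar>noise r t \<omega>\<bar> + \<bar>\<alpha> t\<bar> * \<bar>e t \<omega>\<bar>"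
      by (auto simp: noise_def abs_mult[symmetric] intro: order_trans[OF abs_triangle_ineq])
    also have "\<dots> \<le> 1 * (c * real t) + 1 * c"
    proof -
      have "\<bar>1 - \<alpha> t * d t \<omega>\<bar> \<le> 1"
        using damping_bounds[of t \<omega>] mult_nonneg_nonneg[OF \<alpha>(1)[of t] \<sigma>] by linarith
      then show ?thesis
        using \<alpha>[of t] elim by (intro add_mono mult_mono) auto
    qed
    finally show ?case by (simp add: algebra_simps)
  qed
qed

text \<open>The coefficient may be random, so that it can contain a damping factor.\<close>

lemma integrable_cosh_noise:
  assumes [measurable]: "q \<in> borel_measurable M" and "\<And>\<omega>. \<bar>q \<omega>\<bar> \<le> p"
  shows "integrable M (\<lambda>\<omega>. cosh (q \<omega> * noise r t \<omega>))"
proof (rule integrable_const_bound)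
  show "AE \<omega> in M. norm (cosh (q \<omega> * noise r t \<omega>)) \<le> cosh (p * (c * real t))"
    using noise_AE_bounded[of r t]
  proof eventually_elim
    case (elim \<omega>)
    have "cosh \<bar>q \<omega> * noise r t \<omega>\<bar> \<le> cosh (p * (c * real t))"
      using assms(2)[of \<omega>] elim c
      by (subst cosh_real_nonneg_le_iff) (auto simp: abs_mult intro!: mult_mono mult_nonneg_nonneg intro: order_trans[OF abs_ge_zero])
    then show ?case by simp
  qed
qed (unfold cosh_field_def, measurable)

text \<open>The induction ranges over all \<open>l\<close>, because a damped step rescales the
  argument of \<open>cosh\<close>: the hypothesis is used at \<open>l * q\<close>.\<close>

lemma expectation_cosh_noise:
  "expectation (\<lambda>\<omega>. cosh (l * noise r t \<omega>)) \<le> exp (l\<^sup>2 * c\<^sup>2 * proxy_var r t / 2)"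
proof (induction t arbitrary: l)
  case 0
  then show ?case by (simp add: noise_def proxy_var_def prob_space)
next
  case (Suc t)
  define q where "q = 1 - \<alpha> t * \<sigma>"
  have q: "0 \<le> q" "q \<le> 1"
    using \<alpha>[of t] \<sigma> \<sigma>_le_1 by (auto simp: q_def intro: mult_le_one)
  define D where "D \<omega> = l * (1 - \<alpha> t * d t \<omega>)" for \<omega>
  have [measurable]: "D \<in> borel_measurable M" by (simp add: D_def[abs_def])
  have D_le: "\<bar>D \<omega>\<bar> \<le> \<bar>l\<bar> * q" for \<omega>
    using damping_bounds[of t \<omega>] by (auto simp: D_def q_def abs_mult intro!: mult_left_mono)
  \<comment> \<open>Random damping is replaced by its worst case pointwise, so its dependence on the
    past noise does no harm.\<close>
  have "expectation (\<lambda>\<omega>. cosh (D \<omega> * noise r t \<omega>)) \<le> expectation (\<lambda>\<omega>. cosh (l * q * noise r t \<omega>))"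
  proof (rule integral_mono)
    show "integrable M (\<lambda>\<omega>. cosh (D \<omega> * noise r t \<omega>))"
      by (rule integrable_cosh_noise[OF _ D_le]) simp
    show "integrable M (\<lambda>\<omega>. cosh (l * q * noise r t \<omega>))"
      by (rule integrable_cosh_noise[where p = "\<bar>l * q\<bar>"]) auto
    fix \<omega>
    have "cosh \<bar>D \<omega> * noise r t \<omega>\<bar> \<le> cosh \<bar>l * q * noise r t \<omega>\<bar>"
      using D_le[of \<omega>] q by (subst cosh_real_nonneg_le_iff) (auto simp: abs_mult intro!: mult_right_mono)
    then show "cosh (D \<omega> * noise r t \<omega>) \<le> cosh (l * q * noise r t \<omega>)" by simp
  qed
  also have "\<dots> \<le> exp ((l * q)\<^sup>2 * c\<^sup>2 * proxy_var r t / 2)"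
    by (rule Suc.IH)
  also have "\<dots> \<le> exp (l\<^sup>2 * c\<^sup>2 * (q * proxy_var r t) / 2)"
  proof -
    \<comment> \<open>Here the square is given up, to match the first power in
      \<open>proxy_var\<close>.\<close>
    have "q * q \<le> q" using q mult_left_le by blast
    then have "l\<^sup>2 * c\<^sup>2 * proxy_var r t * (q * q) \<le> l\<^sup>2 * c\<^sup>2 * proxy_var r t * q"
      using proxy_var_nonneg[of r t] by (intro mult_left_mono) auto
    then show ?thesis by (simp add: power2_eq_square algebra_simps)
  qed
  finally have damp: "expectation (\<lambda>\<omega>. cosh (D \<omega> * noise r t \<omega>)) \<le> exp (l\<^sup>2 * c\<^sup>2 * (q * proxy_var r t) / 2)" .
  show ?case
  proof (cases "t mod Suc \<tau> = r")
    case False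
    then have "noise r (Suc t) = (\<lambda>\<omega>. (1 - \<alpha> t * d t \<omega>) * noise r t \<omega>)" "proxy_var r (Suc t) = q * proxy_var r t"
      by (auto simp: noise_def proxy_var_def q_def)
    then show ?thesis
      using damp by (simp add: D_def mult.assoc)
  next
    case True
    define p where "p = l * \<alpha> t"
    \<comment> \<open>In its own class the past noise and \<open>d t\<close> are known at
      \<open>t - \<tau>\<close>, so this is an admissible test function for
      \<open>e_orth\<close>.\<close>
    define Z where "Z \<omega> = sinh (D \<omega> * noise r t \<omega>)" for \<omega>
    have eq: "l * noise r (Suc t) \<omega> = D \<omega> * noise r t \<omega> + p * e t \<omega>" for \<omega>
      using True by (simp add: noise_def D_def p_def algebra_simps)
    have [measurable]: "noise r t \<in> borel_measurable (Fil (t - \<tau>))" "d t \<in> borel_measurable (Fil (t - \<tau>))"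
      using noise_measurable_lag[OF True] d_meas by auto
    have Z_meas: "Z \<in> borel_measurable (Fil (t - \<tau>))"
      unfolding Z_def D_def sinh_field_def by measurable
    have [measurable]: "Z \<in> borel_measurable M"
      by (rule measurable_from_subalg[OF subalg Z_meas])
    have Z_bound: "AE \<omega> in M. \<bar>Z \<omega>\<bar> \<le> cosh (\<bar>l\<bar> * q * (c * real t))"
      using noise_AE_bounded[of r t]
    proof eventually_elim
      case (elim \<omega>)
      have "\<bar>Z \<omega>\<bar> \<le> cosh \<bar>D \<omega> * noise r t \<omega>\<bar>"
        unfolding Z_def by (simp only: sinh_real_abs[symmetric] sinh_le_cosh_real)
      also have "\<dots> \<le> cosh (\<bar>l\<bar> * q * (c * real t))"
        using D_le[of \<omega>] elim c q
        by (subst cosh_real_nonneg_le_iff) (auto simp: abs_mult intro!: mult_mono)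
      finally show ?case .
    qed
    have orth: "expectation (\<lambda>\<omega>. e t \<omega> * Z \<omega>) = 0"
      by (rule e_orth[OF Z_meas Z_bound])
    have int_eZ: "integrable M (\<lambda>\<omega>. e t \<omega> * Z \<omega>)"
    proof (rule integrable_const_bound)
      show "AE \<omega> in M. norm (e t \<omega> * Z \<omega>) \<le> c * cosh (\<bar>l\<bar> * q * (c * real t))"
        using Z_bound e_bound[of t] by eventually_elim (use c in \<open>auto simp: abs_mult intro!: mult_mono\<close>)
    qed simp
    have int_D: "integrable M (\<lambda>\<omega>. cosh (D \<omega> * noise r t \<omega>))"
      by (rule integrable_cosh_noise[OF _ D_le]) simp
    have "expectation (\<lambda>\<omega>. cosh (l * noise r (Suc t) \<omega>))
        \<le> expectation (\<lambda>\<omega>. cosh (D \<omega> * noise r t \<omega>) * cosh (p * c) + sinh (p * c) / c * (e t \<omega> * Z \<omega>))"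
    proof (rule integral_mono_AE)
      show "integrable M (\<lambda>\<omega>. cosh (l * noise r (Suc t) \<omega>))"
        by (rule integrable_cosh_noise[where p = "\<bar>l\<bar>"]) auto
      show "AE \<omega> in M. cosh (l * noise r (Suc t) \<omega>)
          \<le> cosh (D \<omega> * noise r t \<omega>) * cosh (p * c) + sinh (p * c) / c * (e t \<omega> * Z \<omega>)"
        using e_bound[of t] unfolding eq Z_def
        by eventually_elim (use c in \<open>intro cosh_add_le_chord; simp\<close>)
    qed (use int_eZ int_D in simp)
    also have "\<dots> = expectation (\<lambda>\<omega>. cosh (D \<omega> * noise r t \<omega>)) * cosh (p * c)"
      using int_eZ int_D orth by simp
    also have "\<dots> \<le> exp (l\<^sup>2 * c\<^sup>2 * (q * proxy_var r t) / 2) * exp ((p * c)\<^sup>2 / 2)"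
      by (intro mult_mono damp cosh_le_exp_half_square) auto
    also have "\<dots> = exp (l\<^sup>2 * c\<^sup>2 * proxy_var r (Suc t) / 2)"
      using True by (simp add: proxy_var_def q_def p_def power_mult_distrib field_simps flip: exp_add)
    finally show ?thesis .
  qed
qed

text \<open>A Chernoff bound with \<open>cosh x \<ge> exp \<bar>x\<bar> / 2\<close> in place of a
  two-sided argument.\<close>

lemma noise_tail:
  assumes b: "0 < b" and L: "0 < L" and bL: "2 * (c\<^sup>2 * proxy_var r t) * L \<le> b\<^sup>2"
  shows "prob {\<omega> \<in> space M. b \<le> \<bar>noise r t \<omega>\<bar>} \<le> 2 * exp (- L)"
proof -
  \<comment> \<open>If \<open>bL\<close> is an equality, this is the optimal choice
    \<open>b / (c\<^sup>2 * proxy_var r t)\<close>. The variance term is at most \<open>L\<close>,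
    against \<open>l * b = 2 * L\<close> from the threshold.\<close>
  define l where "l = 2 * L / b"
  have l: "0 < l" "l * b = 2 * L" using b L by (auto simp: l_def)
  have [measurable]: "(\<lambda>\<omega>. cosh (l * noise r t \<omega>)) \<in> borel_measurable M"
    unfolding cosh_field_def by measurable
  have "prob {\<omega> \<in> space M. b \<le> \<bar>noise r t \<omega>\<bar>} \<le> prob {\<omega> \<in> space M. exp (2 * L) / 2 \<le> cosh (l * noise r t \<omega>)}"
  proof (intro finite_measure_mono subsetI CollectI conjI)
    fix \<omega> assume "\<omega> \<in> {\<omega> \<in> space M. b \<le> \<bar>noise r t \<omega>\<bar>}"
    then have "l * b \<le> \<bar>l * noise r t \<omega>\<bar>" using l mult_left_mono[of b "\<bar>noise r t \<omega>\<bar>" l] by (simp add: abs_mult)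
    then have "exp (2 * L) / 2 \<le> exp \<bar>l * noise r t \<omega>\<bar> / 2" using l by simp
    also have "\<dots> \<le> cosh \<bar>l * noise r t \<omega>\<bar>" by (simp add: cosh_field_def)
    finally show "exp (2 * L) / 2 \<le> cosh (l * noise r t \<omega>)" by simp
  qed auto
  also have "\<dots> \<le> expectation (\<lambda>\<omega>. cosh (l * noise r t \<omega>)) / (exp (2 * L) / 2)"
    by (intro integral_Markov_inequality_measure[where A = "space M"] integrable_cosh_noise[where p = "\<bar>l\<bar>"]) auto
  also have "\<dots> \<le> exp (l\<^sup>2 * c\<^sup>2 * proxy_var r t / 2) / (exp (2 * L) / 2)"
    by (intro divide_right_mono expectation_cosh_noise) auto
  also have "\<dots> = 2 * exp (l\<^sup>2 * c\<^sup>2 * proxy_var r t / 2 - 2 * L)"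
    by (simp add: exp_diff)
  also have "\<dots> \<le> 2 * exp (- L)"
  proof -
    have "l\<^sup>2 * c\<^sup>2 * proxy_var r t / 2 * L = l\<^sup>2 / 4 * (2 * (c\<^sup>2 * proxy_var r t) * L)"
      by simp
    also have "\<dots> \<le> l\<^sup>2 / 4 * b\<^sup>2"
      by (rule mult_left_mono[OF bL]) simp
    also have "\<dots> = (l * b)\<^sup>2 / 4"
      by (simp add: power_mult_distrib)
    also have "\<dots> = L * L"
      unfolding l(2) by (simp add: power2_eq_square)
    finally have "l\<^sup>2 * c\<^sup>2 * proxy_var r t / 2 \<le> L"
      using L by (rule mult_right_le_imp_le)
    then show ?thesis by simp
  qed
  finally show ?thesis .
qed

lemma total_noise_tail:
  assumes L: "0 < L" and U: "0 < U" "damped (\<lambda>k. \<alpha> k * \<sigma>) (\<lambda>k. (\<alpha> k)\<^sup>2) t \<le> U"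
  shows "prob {\<omega> \<in> space M. 2 * c * sqrt (real (Suc \<tau>) * L * U)
      < \<bar>damped (\<lambda>k. \<alpha> k * d k \<omega>) (\<lambda>k. \<alpha> k * e k \<omega>) t\<bar>} \<le> real (Suc \<tau>) * (2 * exp (- L))"
proof -
  \<comment> \<open>Squared thresholds follow the variances of the classes. The equal shares of
    \<open>U\<close> keep them positive when a class has had no innovation yet and at most double
    the total.\<close>
  define b2 where "b2 r = 2 * (c\<^sup>2 * (proxy_var r t + U / real (Suc \<tau>))) * L" for r
  have b2: "0 < b2 r" for r
    using L U c proxy_var_nonneg[of r t] by (auto simp: b2_def intro!: mult_pos_pos add_nonneg_pos)
  have "(\<Sum>r\<le>\<tau>. proxy_var r t) \<le> U"
    unfolding proxy_var_def damped_residues by (rule U)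
  moreover have "(\<Sum>r\<le>\<tau>. b2 r) = 2 * c\<^sup>2 * L * ((\<Sum>r\<le>\<tau>. proxy_var r t) + U)"
    by (simp add: b2_def sum.distrib distrib_left sum_distrib_left sum_distrib_right mult_ac)
  ultimately have sum_b2: "(\<Sum>r\<le>\<tau>. b2 r) \<le> 2 * c\<^sup>2 * L * (U + U)"
    using L by (simp only:) (intro mult_left_mono, auto)
  \<comment> \<open>Cauchy-Schwarz over the \<open>Suc \<tau>\<close> classes; this produces the
    factor \<open>Suc \<tau>\<close> under the root.\<close>
  have "(\<Sum>r\<le>\<tau>. sqrt (b2 r))\<^sup>2 \<le> (\<Sum>r\<le>\<tau>. (sqrt (b2 r))\<^sup>2) * card {..\<tau>}"
    by (rule sum_squared_le_sum_of_squares)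
  also have "\<dots> = (\<Sum>r\<le>\<tau>. b2 r) * real (Suc \<tau>)"
    using b2 by (simp add: less_imp_le)
  also have "\<dots> \<le> 2 * c\<^sup>2 * L * (U + U) * real (Suc \<tau>)"
    by (rule mult_right_mono[OF sum_b2]) simp
  also have "\<dots> = (2 * c * sqrt (real (Suc \<tau>) * L * U))\<^sup>2"
    using L U by (simp add: power_mult_distrib mult_ac)
  finally have cs: "(\<Sum>r\<le>\<tau>. sqrt (b2 r)) \<le> 2 * c * sqrt (real (Suc \<tau>) * L * U)"
    using c L U by (auto intro: power2_le_imp_le)
  have "prob {\<omega> \<in> space M. 2 * c * sqrt (real (Suc \<tau>) * L * U)
      < \<bar>damped (\<lambda>k. \<alpha> k * d k \<omega>) (\<lambda>k. \<alpha> k * e k \<omega>) t\<bar>}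
    \<le> prob (\<Union>r\<le>\<tau>. {\<omega> \<in> space M. sqrt (b2 r) \<le> \<bar>noise r t \<omega>\<bar>})"
  proof (intro finite_measure_mono subsetI)
    fix \<omega> assume \<omega>: "\<omega> \<in> {\<omega> \<in> space M. 2 * c * sqrt (real (Suc \<tau>) * L * U)
      < \<bar>damped (\<lambda>k. \<alpha> k * d k \<omega>) (\<lambda>k. \<alpha> k * e k \<omega>) t\<bar>}"
    have "damped (\<lambda>k. \<alpha> k * d k \<omega>) (\<lambda>k. \<alpha> k * e k \<omega>) t = (\<Sum>r\<le>\<tau>. noise r t \<omega>)"
      unfolding noise_def by (rule damped_residues[symmetric])
    then have "\<bar>damped (\<lambda>k. \<alpha> k * d k \<omega>) (\<lambda>k. \<alpha> k * e k \<omega>) t\<bar> \<le> (\<Sum>r\<le>\<tau>. \<bar>noise r t \<omega>\<bar>)"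
      by (simp add: sum_abs)
    then have "\<not> (\<forall>r\<le>\<tau>. \<bar>noise r t \<omega>\<bar> < sqrt (b2 r))"
      using \<omega> cs sum_mono[of "{..\<tau>}" "\<lambda>r. \<bar>noise r t \<omega>\<bar>" "\<lambda>r. sqrt (b2 r)"] by force
    then show "\<omega> \<in> (\<Union>r\<le>\<tau>. {\<omega> \<in> space M. sqrt (b2 r) \<le> \<bar>noise r t \<omega>\<bar>})"
      using \<omega> by (auto simp: not_less)
  qed simp
  also have "\<dots> \<le> (\<Sum>r\<le>\<tau>. prob {\<omega> \<in> space M. sqrt (b2 r) \<le> \<bar>noise r t \<omega>\<bar>})"
    by (rule measure_UNION_le) auto
  also have "\<dots> \<le> (\<Sum>r\<le>\<tau>. 2 * exp (- L))"
  proof (intro sum_mono noise_tail L)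
    fix r
    show "0 < sqrt (b2 r)" using b2 by simp
    show "2 * (c\<^sup>2 * proxy_var r t) * L \<le> (sqrt (b2 r))\<^sup>2"
      using b2[of r] L U by (simp add: less_imp_le) (simp add: b2_def distrib_left)
  qed
  finally show ?thesis by simp
qed

end

subsection \<open>Contractions in the weighted norm\<close>

lemma weighted_infnorm_le_iff:
  fixes v x :: "real ^ 'n"
  assumes "\<And>j. v $ j > 0"
  shows "weighted_infnorm v x \<le> B \<longleftrightarrow> (\<forall>j. \<bar>x $ j\<bar> \<le> B * v $ j)"
  unfolding weighted_infnorm_def using assms
  by (subst cSUP_le_iff) (auto simp: pos_divide_le_eq)

lemma abs_component_le_weighted_infnorm:
  fixes v x :: "real ^ 'n"
  assumes "\<And>j. v $ j > 0"
  shows "\<bar>x $ j\<bar> \<le> weighted_infnorm v x * v $ j"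
  using weighted_infnorm_le_iff[OF assms, where x = x and B = "weighted_infnorm v x"] by auto

lemma weighted_infnorm_nonneg:
  fixes v x :: "real ^ 'n"
  assumes "\<And>j. v $ j > 0"
  shows "0 \<le> weighted_infnorm v x"
  using abs_component_le_weighted_infnorm[OF assms, where x = x and j = undefined] assms[of undefined]
  by (smt (verit) abs_ge_zero zero_le_mult_iff)

lemma weighted_infnorm_diff_le:
  fixes v x y :: "real ^ 'n"
  assumes "\<And>j. v $ j > 0"
  shows "weighted_infnorm v (x - y) \<le> weighted_infnorm v x + weighted_infnorm v y"
  unfolding weighted_infnorm_le_iff[OF assms]
proof
  fix j
  show "\<bar>(x - y) $ j\<bar> \<le> (weighted_infnorm v x + weighted_infnorm v y) * v $ j"
    using abs_component_le_weighted_infnorm[OF assms, where x = x and j = j]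
      abs_component_le_weighted_infnorm[OF assms, where x = y and j = j]
    by (simp add: distrib_right)
qed

lemma norm_le_weighted_infnorm:
  fixes v x :: "real ^ 'n"
  assumes "\<And>j. v $ j > 0"
  shows "norm x \<le> (\<Sum>j\<in>UNIV. v $ j) * weighted_infnorm v x"
proof -
  have "norm x \<le> (\<Sum>j\<in>UNIV. \<bar>x $ j\<bar>)"
    by (rule norm_le_l1_cart)
  also have "\<dots> \<le> (\<Sum>j\<in>UNIV. weighted_infnorm v x * v $ j)"
    by (intro sum_mono abs_component_le_weighted_infnorm assms)
  finally show ?thesis by (simp add: sum_distrib_left mult.commute)
qed

lemma Min_components_pos:
  fixes v :: "real ^ 'n"
  assumes "\<And>j. v $ j > 0"
  shows "0 < (MIN j. v $ j)" "(MIN j. v $ j) \<le> v $ k"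
  using assms by (auto simp: Min_gr_iff)

lemma weighted_infnorm_le_norm:
  fixes v x :: "real ^ 'n"
  assumes "\<And>j. v $ j > 0"
  shows "weighted_infnorm v x \<le> norm x / (MIN j. v $ j)"
  unfolding weighted_infnorm_le_iff[OF assms]
proof
  fix j
  note m = Min_components_pos[of v, OF assms]
  have "\<bar>x $ j\<bar> \<le> norm x * 1"
    by (simp add: component_le_norm_cart)
  also have "\<dots> \<le> norm x * (v $ j / (MIN j. v $ j))"
    using m by (intro mult_left_mono) (auto simp: le_divide_eq)
  finally show "\<bar>x $ j\<bar> \<le> norm x / (MIN j. v $ j) * v $ j" by simp
qed

locale weighted_contraction =
  fixes F :: "real ^ 'n \<Rightarrow> real ^ 'n" and v :: "real ^ 'n" and \<gamma> C :: real
  assumes v_pos: "v $ j > 0"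
    and \<gamma>: "0 < \<gamma>" "\<gamma> < 1"
    and contraction: "weighted_infnorm v (F y - F z) \<le> \<gamma> * weighted_infnorm v (y - z)"
    and growth: "weighted_infnorm v (F y) \<le> \<gamma> * weighted_infnorm v y + C"
begin

lemmas component_le = abs_component_le_weighted_infnorm[of v, OF v_pos]
lemmas le_iff = weighted_infnorm_le_iff[of v, OF v_pos]

lemma funpow_contraction:
  "weighted_infnorm v ((F ^^ k) y - (F ^^ k) z) \<le> \<gamma> ^ k * weighted_infnorm v (y - z)"
proof (induction k)
  case (Suc k)
  show ?case
    using order_trans[OF contraction mult_left_mono[OF Suc, of \<gamma>]] \<gamma> by (simp add: mult.assoc)
qed simp

text \<open>Equivalence of the two norms costs a factor that does not depend on \<open>k\<close>, so
  high iterates contract in the Euclidean metric of the type as well.\<close>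

lemma dist_funpow_le:
  "dist ((F ^^ k) y) ((F ^^ k) z) \<le> (\<Sum>j\<in>UNIV. v $ j) / (MIN j. v $ j) * \<gamma> ^ k * dist y z"
proof -
  have S: "0 \<le> (\<Sum>j\<in>UNIV. v $ j)"
    using v_pos by (simp add: sum_nonneg less_imp_le)
  have "dist ((F ^^ k) y) ((F ^^ k) z) \<le> (\<Sum>j\<in>UNIV. v $ j) * weighted_infnorm v ((F ^^ k) y - (F ^^ k) z)"
    unfolding dist_norm by (rule norm_le_weighted_infnorm[OF v_pos])
  also have "\<dots> \<le> (\<Sum>j\<in>UNIV. v $ j) * (\<gamma> ^ k * (norm (y - z) / (MIN j. v $ j)))"
    using S \<gamma> weighted_infnorm_le_norm[of v "y - z", OF v_pos]
    by (intro mult_left_mono order_trans[OF funpow_contraction]) auto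
  finally show ?thesis by (simp add: dist_norm)
qed

text \<open>Banach's theorem is applied to a power of \<open>F\<close> that contracts in the
  Euclidean metric. As \<open>F\<close> commutes with its powers, it maps the fixed point of that
  power to another one, hence to itself.\<close>

lemma ex1_fixed_point: "\<exists>!y. F y = y"
proof -
  define S where "S = (\<Sum>j\<in>UNIV. v $ j) / (MIN j. v $ j)"
  have S: "0 < S"
    unfolding S_def using v_pos Min_components_pos[of v, OF v_pos] by (intro divide_pos_pos sum_pos) auto
  obtain k where "\<gamma> ^ k < 1 / S"
    using real_arch_pow_inv[of "1 / S" \<gamma>] S \<gamma> by auto
  then have k: "0 \<le> S * \<gamma> ^ k" "S * \<gamma> ^ k < 1"
    using S \<gamma> by (simp_all add: pos_less_divide_eq mult.commute)
  have "\<exists>!y. (F ^^ k) y = y"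
    using dist_funpow_le unfolding S_def[symmetric] by (intro banach_fix_type[OF k]) auto
  then obtain y where y: "(F ^^ k) y = y" and unique: "\<And>z. (F ^^ k) z = z \<Longrightarrow> z = y"
    by blast
  have "(F ^^ k) (F y) = F y"
    using y by (simp add: funpow_swap1[symmetric])
  then have "F y = y" by (rule unique)
  moreover have "z = y" if "F z = z" for z
  proof (rule unique)
    show "(F ^^ k) z = z" using that by (induction k) auto
  qed
  ultimately show ?thesis by blast
qed

lemma borel_measurable_F [measurable]: "F \<in> borel_measurable borel"
proof -
  define S where "S = (\<Sum>j\<in>UNIV. v $ j) / (MIN j. v $ j)"
  have S: "0 < S"
    unfolding S_def using v_pos Min_components_pos[of v, OF v_pos] by (intro divide_pos_pos sum_pos) auto
  have "(S * \<gamma>)-lipschitz_on UNIV F"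
  proof (rule lipschitz_onI)
    show "dist (F y) (F z) \<le> S * \<gamma> * dist y z" for y z
      using dist_funpow_le[of 1] by (simp add: S_def)
  qed (use S \<gamma> in simp)
  then show ?thesis
    by (intro borel_measurable_continuous_onI lipschitz_on_continuous_on)
qed

lemma residual_le:
  assumes "weighted_infnorm v y \<le> xbar"
  shows "\<bar>(F y - y) $ j\<bar> \<le> (2 * xbar + C) * v $ j"
proof -
  have "weighted_infnorm v (F y - y) \<le> (\<gamma> * weighted_infnorm v y + C) + weighted_infnorm v y"
    by (rule order_trans[OF weighted_infnorm_diff_le[OF v_pos] add_right_mono[OF growth]])
  also have "\<dots> \<le> 2 * xbar + C"
    using assms mult_right_mono[of \<gamma> 1 "weighted_infnorm v y"] \<gamma> weighted_infnorm_nonneg[of v y, OF v_pos]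
    by simp
  finally show ?thesis by (simp add: le_iff)
qed

text \<open>The innovation multiplying the step size in component \<open>j\<close>, in units of \<open>v $ j\<close>.  The
  residual is read off \<open>\<tau>\<close> steps in the past, so that with \<open>D k\<close> the conditional
  probability of \<open>i k = j\<close> given that past the innovation is conditionally centred.\<close>

definition innovation ::
  "nat \<Rightarrow> (nat \<Rightarrow> real ^ 'n) \<Rightarrow> (nat \<Rightarrow> 'n) \<Rightarrow> (nat \<Rightarrow> real) \<Rightarrow> (nat \<Rightarrow> real) \<Rightarrow> 'n \<Rightarrow> nat \<Rightarrow> real" where
  "innovation \<tau> x i w D j k = (if k < \<tau> then 0 else
    ((of_bool (i k = j) - D k) * (F (x (k - \<tau>)) - x (k - \<tau>)) $ j + of_bool (i k = j) * w k) / v $ j)"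

text \<open>An indicator differs from a number in the unit interval by at most 1, so one residual
  and one noise term suffice.\<close>

lemma innovation_bound:
  assumes "weighted_infnorm v (x (k - \<tau>)) \<le> xbar" "0 \<le> xbar" "0 \<le> C" "\<bar>w k\<bar> \<le> wbar" "0 \<le> D k" "D k \<le> 1"
  shows "\<bar>innovation \<tau> x i w D j k\<bar> \<le> 2 * xbar + C + wbar / (MIN j. v $ j)"
proof (cases "k < \<tau>")
  case True
  have "0 \<le> wbar" using assms(4) by linarith
  then show ?thesis
    using True assms divide_nonneg_pos[OF _ Min_components_pos(1)[of v, OF v_pos], of wbar]
    unfolding innovation_def by simp
next
  case False
  note m = Min_components_pos[of v, OF v_pos]
  have wbar: "0 \<le> wbar" using assms(4) by linarith
  have "\<bar>(of_bool (i k = j) - D k) * (F (x (k - \<tau>)) - x (k - \<tau>)) $ j + of_bool (i k = j) * w k\<bar>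
      \<le> \<bar>of_bool (i k = j) - D k\<bar> * \<bar>(F (x (k - \<tau>)) - x (k - \<tau>)) $ j\<bar> + \<bar>of_bool (i k = j)\<bar> * \<bar>w k\<bar>"
    unfolding abs_mult[symmetric] by (rule abs_triangle_ineq)
  also have "\<dots> \<le> 1 * ((2 * xbar + C) * v $ j) + 1 * wbar"
    using assms residual_le[OF assms(1)] by (intro add_mono mult_mono) (auto simp: of_bool_def)
  also have "1 * wbar \<le> wbar / (MIN j. v $ j) * v $ j"
    using m(1) m(2)[of j] wbar mult_left_mono[OF m(2)[of j] wbar] by (simp add: le_divide_eq)
  finally show ?thesis
    using False v_pos[of j] by (simp add: innovation_def pos_divide_le_eq distrib_right)
qed

text \<open>The indicator is split into \<open>D t\<close> and its deviation, and the residual under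
  the deviation into its lagged value, which belongs to the innovation, and the change since then.
  Writing \<open>F x - x\<close> as \<open>(F x - xs) - (x - xs)\<close> separates contraction from
  damping.\<close>

lemma async_step:
  fixes x :: "nat \<Rightarrow> real ^ 'n" and a d :: real
  assumes "x (Suc t) $ j = x t $ j + of_bool (i t = j) * a * (F (x t) $ j - x t $ j + w t)" and "\<tau> \<le> t"
  shows "(x (Suc t) $ j - xs $ j) / v $ j - ((1 - a * D t) * n + a * innovation \<tau> x i w D j t)
    = (1 - a * D t) * ((x t $ j - xs $ j) / v $ j - n) + a * D t * ((F (x t) - xs) $ j / v $ j)
      + a * ((of_bool (i t = j) - D t)
          * ((F (x t) - F (x (t - \<tau>))) $ j - (x t - x (t - \<tau>)) $ j) / v $ j)"
  using assms(2) unfolding assms(1) innovation_def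
  by (simp add: add_divide_distrib diff_divide_distrib algebra_simps)

text \<open>Each update moves a component by at most the step size times the residual and noise
  bound; steps decrease, so the first one dominates the window.\<close>

lemma async_drift:
  fixes x :: "nat \<Rightarrow> real ^ 'n" and h t0 :: real
  assumes x_Suc: "\<And>t j. x (Suc t) $ j = x t $ j + of_bool (i t = j) * (h / (real t + t0)) * (F (x t) $ j - x t $ j + w t)"
    and x_bound: "\<And>t. weighted_infnorm v (x t) \<le> xbar" and w_bound: "\<And>t. \<bar>w t\<bar> \<le> wbar"
    and h: "0 < h" and t0: "0 < t0" and nonneg: "0 \<le> xbar" "0 \<le> C" "0 \<le> wbar"
  shows "weighted_infnorm v (x (p + m) - x p)
    \<le> real m * (h / (real p + t0) * (2 * xbar + C + wbar / (MIN j. v $ j)))"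
proof (induction m)
  case 0
  then show ?case by (simp add: le_iff)
next
  case (Suc m)
  define E where "E = 2 * xbar + C + wbar / (MIN j. v $ j)"
  note M = Min_components_pos[of v, OF v_pos]
  have E: "0 \<le> E" using nonneg divide_nonneg_pos[OF nonneg(3) M(1)] unfolding E_def by linarith
  show ?case
    unfolding le_iff E_def[symmetric]
  proof
    fix j
    have "\<bar>F (x (p + m)) $ j - x (p + m) $ j + w (p + m)\<bar> \<le> (2 * xbar + C) * v $ j + wbar"
      using residual_le[OF x_bound[of "p + m"], of j] w_bound[of "p + m"] by simp
    also have "wbar \<le> wbar / (MIN j. v $ j) * v $ j"
      using M(1) mult_left_mono[OF M(2)[of j] nonneg(3)] by (simp add: le_divide_eq)
    finally have 1: "\<bar>F (x (p + m)) $ j - x (p + m) $ j + w (p + m)\<bar> \<le> E * v $ j"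
      by (simp add: E_def distrib_right)
    have "\<bar>x (p + Suc m) $ j - x (p + m) $ j\<bar>
        = of_bool (i (p + m) = j) * (h / (real (p + m) + t0)) * \<bar>F (x (p + m)) $ j - x (p + m) $ j + w (p + m)\<bar>"
      using h t0 by (simp add: x_Suc abs_mult)
    also have "\<dots> \<le> (1 * (h / (real p + t0))) * (E * v $ j)"
      using h t0 1 by (intro mult_mono divide_left_mono) auto
    finally have "\<bar>x (p + Suc m) $ j - x (p + m) $ j\<bar> \<le> h / (real p + t0) * E * v $ j"
      by (simp add: mult_ac)
    moreover have "\<bar>x (p + m) $ j - x p $ j\<bar> \<le> real m * (h / (real p + t0) * E) * v $ j"
      using Suc by (simp add: le_iff E_def)
    ultimately show "\<bar>(x (p + Suc m) - x p) $ j\<bar> \<le> real (Suc m) * (h / (real p + t0) * E) * v $ j"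
      unfolding vector_minus_component of_nat_Suc distrib_right by linarith
  qed
qed

text \<open>Chance enters only through the assumed bound on \<open>n\<close>. The induction tracks
  the error minus the noise with coefficient \<open>P = A - K\<close>, for all components at once,
  since the contraction acts on the whole norm.\<close>

lemma async_pathwise_bound:
  fixes x :: "nat \<Rightarrow> real ^ 'n" and i :: "nat \<Rightarrow> 'n" and w :: "nat \<Rightarrow> real"
    and D :: "'n \<Rightarrow> nat \<Rightarrow> real" and h t0 \<sigma> A K Q \<epsilon> :: real and \<tau> T :: nat
  defines "n \<equiv> \<lambda>t j. damped (\<lambda>k. h / (real k + t0) * D j k) (\<lambda>k. h / (real k + t0) * innovation \<tau> x i w (D j) j k) t"
  assumes x_Suc: "\<And>t j. x (Suc t) $ j = x t $ j + of_bool (i t = j) * (h / (real t + t0)) * (F (x t) $ j - x t $ j + w t)"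
    and fixed: "F xs = xs"
    and x_bound: "\<And>t. weighted_infnorm v (x t) \<le> xbar" and xs_bound: "weighted_infnorm v xs \<le> xbar"
    and w_bound: "\<And>t. \<bar>w t\<bar> \<le> wbar"
    and D: "\<And>j t. \<sigma> \<le> D j t" "\<And>j t. D j t \<le> 1"
    and \<sigma>: "0 < \<sigma>" and h: "2 \<le> h * \<sigma> * (1 - \<gamma>)" and t0: "h \<le> t0" "real \<tau> \<le> t0"
    and nonneg: "0 \<le> C" "0 \<le> wbar"
    and \<epsilon>: "\<epsilon> = 2 * xbar + C + wbar / (MIN j. v $ j)"
    and Q: "8 * \<epsilon> * h * real \<tau> / (\<sigma> * (1 - \<gamma>)) \<le> Q" "2 * xbar * (real \<tau> + t0) \<le> Q"
    and K: "0 \<le> K" "K \<le> 3 / 4 * (1 - \<gamma>) * A"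
    and noise: "\<And>t j. t \<le> T \<Longrightarrow> \<bar>n t j\<bar> \<le> K / sqrt (real t + t0)"
  shows "weighted_infnorm v (x T - xs) \<le> A / sqrt (real T + t0) + Q / (real T + t0)"
proof -
  have h_pos: "0 < h"
    using h \<sigma> \<gamma> zero_less_mult_pos2[of h "\<sigma> * (1 - \<gamma>)"] by (simp add: mult.assoc)
  have t0_pos: "0 < t0" using h_pos t0 by linarith
  have s_pos: "0 < real t + t0" for t using t0_pos by simp
  have xbar: "0 \<le> xbar"
    using order_trans[OF weighted_infnorm_nonneg[of v xs, OF v_pos] xs_bound] .
  have \<epsilon>0: "0 \<le> \<epsilon>"
    using nonneg xbar divide_nonneg_pos[OF nonneg(2) Min_components_pos(1)[of v, OF v_pos]]
    unfolding \<epsilon> by linarith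
  have Q0: "0 \<le> Q"
    using Q(2) xbar t0_pos by (meson add_nonneg_pos less_imp_le mult_nonneg_nonneg of_nat_0_le_iff order_trans zero_le_numeral)
  have A0: "0 \<le> A"
    using K \<gamma> zero_le_mult_iff[of "3 / 4 * (1 - \<gamma>)" A] by auto
  have KA: "K \<le> A"
    using K(2) mult_right_mono[of "3 / 4 * (1 - \<gamma>)" 1 A] A0 \<gamma> by simp
  define a where "a t = weighted_infnorm v (x t - xs)" for t
  define y where "y t j = (x t $ j - xs $ j) / v $ j" for t j
  have a_le: "a t \<le> b \<longleftrightarrow> (\<forall>j. \<bar>y t j\<bar> \<le> b)" for t b
    using v_pos by (simp add: a_def y_def le_iff pos_divide_le_eq abs_divide abs_of_pos)
  have a_2xbar: "a t \<le> 2 * xbar" for t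
    using weighted_infnorm_diff_le[of v "x t" xs, OF v_pos] x_bound[of t] xs_bound by (simp add: a_def)
  \<comment> \<open>Up to time \<open>\<tau>\<close> the trivial bound \<open>2 * xbar\<close> is
    enough; this is the purpose of the second lower bound on \<open>Q\<close>.\<close>
  have early: "a t \<le> Q / (real t + t0)" if "t \<le> \<tau>" for t
  proof -
    have "a t * (real t + t0) \<le> 2 * xbar * (real \<tau> + t0)"
      using a_2xbar[of t] that t0_pos xbar by (intro mult_mono) auto
    then show ?thesis using Q(2) s_pos[of t] by (simp add: le_divide_eq)
  qed
  define P where "P = A - K"
  have total: "a t \<le> A / sqrt (real t + t0) + Q / (real t + t0)"
    if "t \<le> T" and "\<And>j. \<bar>y t j - n t j\<bar> \<le> P / sqrt (real t + t0) + Q / (real t + t0)" for t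
    unfolding a_le
  proof
    fix j
    show "\<bar>y t j\<bar> \<le> A / sqrt (real t + t0) + Q / (real t + t0)"
      using that(2)[of j] noise[OF that(1), of j] by (simp add: P_def diff_divide_distrib)
  qed
  have main: "\<forall>j. \<bar>y t j - n t j\<bar> \<le> P / sqrt (real t + t0) + Q / (real t + t0)" if "\<tau> \<le> t" "t \<le> T" for t
    using that
  proof (induction t rule: dec_induct)
    case base
    \<comment> \<open>Innovations before \<open>\<tau>\<close> are zero by definition, and
      \<open>n\<close> at time \<open>\<tau>\<close> sees only those.\<close>
    have zero: "n t j = 0" if "t \<le> \<tau>" for t j
      using that unfolding n_def by (induction t) (auto simp: innovation_def)
    have "\<bar>y \<tau> j\<bar> \<le> Q / (real \<tau> + t0)" for j
      using early[of \<tau>] by (simp add: a_le)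
    moreover have "0 \<le> P / sqrt (real \<tau> + t0)"
      using KA t0_pos by (simp add: P_def)
    ultimately show ?case
      by (simp add: zero add_increasing)
  next
    case (step t)
    define s where "s = real t + t0"
    have s: "0 < s" using s_pos by (simp add: s_def)
    have IH: "\<bar>y t j - n t j\<bar> \<le> P / sqrt s + Q / s" for j
      using step by (simp add: s_def)
    have at: "a t \<le> A / sqrt s + Q / s"
      using total[of t] step IH by (simp add: s_def)
    have drift: "weighted_infnorm v (x t - x (t - \<tau>)) \<le> 2 * \<epsilon> * h * real \<tau> / s"
    proof -
      have "weighted_infnorm v (x (t - \<tau> + \<tau>) - x (t - \<tau>)) \<le> real \<tau> * (h / (real (t - \<tau>) + t0) * \<epsilon>)"
        unfolding \<epsilon> by (rule async_drift[OF x_Suc x_bound w_bound h_pos t0_pos xbar nonneg])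
      \<comment> \<open>From \<open>\<tau> \<le> t\<close> and \<open>\<tau> \<le> t0\<close>
        follows \<open>s / 2 \<le> t - \<tau> + t0\<close>: the lagged step size is at most twice
        the current one.\<close>
      also have "h / (real (t - \<tau>) + t0) \<le> h / (s / 2)"
        using step(1) t0 h_pos t0_pos by (intro divide_left_mono) (auto simp: s_def of_nat_diff)
      finally show ?thesis
        using step(1) \<epsilon>0 by (simp add: mult_left_mono mult_right_mono mult_ac)
    qed
    show ?case
    proof
      fix j
      define \<phi> where "\<phi> = (of_bool (i t = j) - D j t)
          * ((F (x t) - F (x (t - \<tau>))) $ j - (x t - x (t - \<tau>)) $ j) / v $ j"
      have Dj: "0 \<le> D j t" "D j t \<le> 1" using D(2)[of j t] D(1)[of j t] \<sigma> by auto
      have eq: "y (Suc t) j - n (Suc t) j = (1 - h / s * D j t) * (y t j - n t j)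
          + h / s * D j t * ((F (x t) - xs) $ j / v $ j) + h / s * \<phi>"
        using async_step[where a = "h / s" and n = "n t j" and D = "D j" and xs = xs, OF _ step(1)] x_Suc[of t j]
        by (simp add: y_def n_def s_def \<phi>_def)
      have hDs: "h * D j t \<le> s"
        using mult_left_mono[OF Dj(2) less_imp_le[OF h_pos]] t0 unfolding s_def by linarith
      have "\<bar>(F (x t) - F xs) $ j\<bar> \<le> \<gamma> * a t * v $ j"
        using contraction[of "x t" xs] unfolding a_def le_iff by blast
      then have Fx: "\<bar>(F (x t) - xs) $ j / v $ j\<bar> \<le> \<gamma> * a t"
        using v_pos[of j] fixed by (simp add: pos_divide_le_eq abs_divide)
      have "\<bar>(F (x t) - F (x (t - \<tau>))) $ j\<bar> \<le> \<gamma> * weighted_infnorm v (x t - x (t - \<tau>)) * v $ j"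
        using contraction[of "x t" "x (t - \<tau>)"] unfolding le_iff by blast
      also have "\<dots> \<le> 1 * weighted_infnorm v (x t - x (t - \<tau>)) * v $ j"
        using \<gamma> v_pos[of j] weighted_infnorm_nonneg[of v, OF v_pos] by (intro mult_right_mono) auto
      finally have 1: "\<bar>(F (x t) - F (x (t - \<tau>))) $ j - (x t - x (t - \<tau>)) $ j\<bar>
          \<le> 2 * weighted_infnorm v (x t - x (t - \<tau>)) * v $ j"
        using component_le[of "x t - x (t - \<tau>)" j] by linarith
      have "\<bar>of_bool (i t = j) - D j t\<bar> * \<bar>(F (x t) - F (x (t - \<tau>))) $ j - (x t - x (t - \<tau>)) $ j\<bar>
          \<le> 1 * (2 * weighted_infnorm v (x t - x (t - \<tau>)) * v $ j)"
        using Dj 1 by (intro mult_mono) (auto simp: of_bool_def)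
      then have "\<bar>\<phi>\<bar> \<le> 2 * weighted_infnorm v (x t - x (t - \<tau>))"
        using v_pos[of j] by (simp add: \<phi>_def abs_mult pos_divide_le_eq)
      also have "\<dots> \<le> 2 * (2 * \<epsilon> * h * real \<tau> / s)"
        using drift by simp
      \<comment> \<open>Doubling for the step size, for the change of \<open>F x - x\<close> and for
        the half share of \<open>Q\<close> gives the constant 8.\<close>
      also have "\<dots> \<le> \<sigma> * (1 - \<gamma>) * Q / (2 * s)"
      proof -
        have "8 * \<epsilon> * h * real \<tau> \<le> Q * (\<sigma> * (1 - \<gamma>))"
          using Q(1) \<sigma> \<gamma> by (simp add: pos_divide_le_eq)
        then show ?thesis
          using s by (simp add: field_simps)
      qed
      finally have \<phi>: "\<bar>\<phi>\<bar> \<le> \<sigma> * (1 - \<gamma>) * Q / (2 * s)" .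
      have "\<bar>y (Suc t) j - n (Suc t) j\<bar> \<le> (1 - h / s * D j t) * \<bar>y t j - n t j\<bar>
          + h / s * D j t * (\<gamma> * a t) + h / s * \<bar>\<phi>\<bar>"
      proof -
        have "0 \<le> 1 - h / s * D j t"
          using hDs s by (simp add: divide_le_eq)
        then have n1: "\<bar>(1 - h / s * D j t) * (y t j - n t j)\<bar> = (1 - h / s * D j t) * \<bar>y t j - n t j\<bar>"
          by (simp add: abs_mult)
        have n2: "\<bar>h / s * D j t * ((F (x t) - xs) $ j / v $ j)\<bar> \<le> h / s * D j t * (\<gamma> * a t)"
          unfolding abs_mult[of "h / s * D j t"]
          using Fx h_pos s Dj by (intro mult_mono) auto
        have n3: "\<bar>h / s * \<phi>\<bar> = h / s * \<bar>\<phi>\<bar>"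
          using h_pos s by (simp add: abs_mult)
        show ?thesis
          unfolding eq
          by (intro order_trans[OF abs_triangle_ineq add_mono] order_trans[OF abs_triangle_ineq add_mono]
              eq_refl[OF n1] n2 eq_refl[OF n3])
      qed
      then have "\<bar>y (Suc t) j - n (Suc t) j\<bar> \<le> P / sqrt (s + 1) + Q / (s + 1)"
        using decay_step[OF s hDs D(1) h_pos \<gamma> \<sigma> h A0 _ _ Q0 IH at \<phi>] K by (simp add: P_def)
      then show "\<bar>y (Suc t) j - n (Suc t) j\<bar> \<le> P / sqrt (real (Suc t) + t0) + Q / (real (Suc t) + t0)"
        by (simp add: s_def add_ac)
    qed
  qed
  show ?thesis
  proof (cases "\<tau> \<le> T")
    case True
    then show ?thesis using total[of T] main[of T] by (simp add: a_def)
  next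
    case False
    then have "a T \<le> Q / (real T + t0)" by (intro early) auto
    moreover have "0 \<le> A / sqrt (real T + t0)" using A0 t0_pos by simp
    ultimately show ?thesis by (simp add: a_def)
  qed
qed

end

subsection \<open>The high-probability bound\<close>

lemma borel_measurable_vec_nth [measurable]:
  fixes f :: "'a \<Rightarrow> real ^ 'n"
  assumes "f \<in> borel_measurable N"
  shows "(\<lambda>\<omega>. f \<omega> $ j) \<in> borel_measurable N"
  using borel_measurable_inner[OF assms borel_measurable_const[of "axis j 1"]]
  by (simp add: inner_axis)

text \<open>Known factors are pulled out of the conditional expectation; this supplies the
  orthogonality demanded by \<open>lagged_noise\<close>.\<close>

lemma (in prob_space) expectation_mult_cond_centred:
  assumes "subalgebra M G"
    and Z: "Z \<in> borel_measurable G" "AE \<omega> in M. \<bar>Z \<omega>\<bar> \<le> b"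
    and w: "w \<in> borel_measurable M" "AE \<omega> in M. \<bar>w \<omega>\<bar> \<le> b'"
    and centred: "AE \<omega> in M. real_cond_exp M G w \<omega> = 0"
  shows "integrable M (\<lambda>\<omega>. Z \<omega> * w \<omega>)" "expectation (\<lambda>\<omega>. Z \<omega> * w \<omega>) = 0"
proof -
  interpret finite_measure_subalgebra M G
    by unfold_locales (fact assms(1))
  have [measurable]: "w \<in> borel_measurable M" "Z \<in> borel_measurable M"
    using w measurable_from_subalg[OF assms(1) Z(1)] by auto
  show int: "integrable M (\<lambda>\<omega>. Z \<omega> * w \<omega>)"
  proof (rule integrable_const_bound)
    show "AE \<omega> in M. norm (Z \<omega> * w \<omega>) \<le> b * b'"
      using Z(2) w(2) by eventually_elim (auto simp: abs_mult intro!: mult_mono)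
  qed simp
  have "expectation (\<lambda>\<omega>. Z \<omega> * w \<omega>) = expectation (\<lambda>\<omega>. Z \<omega> * real_cond_exp M G w \<omega>)"
    by (rule real_cond_exp_intg(2)[OF int Z(1) w(1), symmetric])
  also have "\<dots> = expectation (\<lambda>\<omega>. 0)"
    using centred Z by (intro integral_cong_AE) auto
  finally show "expectation (\<lambda>\<omega>. Z \<omega> * w \<omega>) = 0" by simp
qed

theorem theorem4:
  fixes M :: "'a measure"
    and Fil :: "nat \<Rightarrow> 'a measure"
    and F :: "real ^ 'n \<Rightarrow> real ^ 'n"
    and v xstar :: "real ^ 'n"
    and i :: "nat \<Rightarrow> 'a \<Rightarrow> 'n"
    and w :: "nat \<Rightarrow> 'a \<Rightarrow> real"
    and x :: "nat \<Rightarrow> 'a \<Rightarrow> real ^ 'n"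
    and \<alpha> :: "nat \<Rightarrow> real"
    and \<gamma> C wbar \<sigma> xbar h t0 \<epsilon> \<delta> :: real
    and \<tau> T :: nat
  assumes v_pos: "\<And>j. v $ j > 0"
    and prob: "prob_space M"
    and subalg: "\<And>t. subalgebra M (Fil t)"
    and filt: "filtration (space M) Fil"
    and i_adapted: "\<And>t. i t \<in> measurable (Fil t) (count_space UNIV)"
    and x_def: "x = async_sa F \<alpha> i w"
    and \<gamma>: "0 < \<gamma>" "\<gamma> < 1"
    and C: "C > 0"
    and wbar: "wbar \<ge> 0"
    and \<sigma>: "0 < \<sigma>" "\<sigma> < 1"
    and \<tau>: "\<tau> \<ge> 1"
    and F_contraction:
      "\<And>y z. weighted_infnorm v (F y - F z) \<le> \<gamma> * weighted_infnorm v (y - z)"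
    and F_growth: "\<And>y. weighted_infnorm v (F y) \<le> \<gamma> * weighted_infnorm v y + C"
    and xstar: "xstar = (THE y. F y = y)"
    and w_meas: "\<And>t. w t \<in> borel_measurable (Fil (Suc t))"
    and w_mean: "\<And>t. AE \<omega> in M. real_cond_exp M (Fil t) (w t) \<omega> = 0"
    and w_bound: "\<And>t. AE \<omega> in M. \<bar>w t \<omega>\<bar> \<le> wbar"
    and exploration: "\<And>j t. t \<ge> \<tau> \<Longrightarrow>
      AE \<omega> in M. real_cond_exp M (Fil (t - \<tau>)) (indicat_real {\<eta> \<in> space M. i t \<eta> = j}) \<omega> \<ge> \<sigma>"
    and xbar: "xbar \<ge> weighted_infnorm v xstar"
    and x_bound: "\<And>t. AE \<omega> in M. weighted_infnorm v (x t \<omega>) \<le> xbar"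
    and step: "\<And>t. \<alpha> t = h / (real t + t0)"
    and t0: "t0 \<ge> max (4 * h) (real \<tau>)"
    and h: "h \<ge> 2 / (\<sigma> * (1 - \<gamma>))"
    and \<epsilon>: "\<epsilon> = 2 * xbar + C + wbar / (MIN j. v $ j)"
    and T: "T \<ge> 1"
    and \<delta>: "0 < \<delta>" "\<delta> < 1"
  shows "measure M {\<omega> \<in> space M.
      weighted_infnorm v (x T \<omega> - xstar) \<le>
        12 * \<epsilon> / (1 - \<gamma>) * sqrt ((real \<tau> + 1) * h / \<sigma>)
          * sqrt (ln (2 * (real \<tau> + 1) * (real T)\<^sup>2 * real CARD('n) / \<delta>) / (real T + t0))
        + 4 / (1 - \<gamma>) * max (16 * \<epsilon> * h * real \<tau> / \<sigma>) (2 * xbar * (real \<tau> + t0))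
          * (1 / (real T + t0))}
    \<ge> 1 - \<delta>"
proof -
  interpret prob_space M by (rule prob)
  interpret weighted_contraction F v \<gamma> C
    by unfold_locales (fact v_pos \<gamma> F_contraction F_growth)+
  note m = Min_components_pos[of v, OF v_pos]

  \<comment> \<open>Constants and the filtration\<close>
  have fixed: "F xstar = xstar"
    unfolding xstar by (rule theI'[OF ex1_fixed_point])
  have xbar0: "0 \<le> xbar"
    using order_trans[OF weighted_infnorm_nonneg[of v, OF v_pos] xbar] .
  have \<epsilon>0: "0 < \<epsilon>"
    using xbar0 C divide_nonneg_pos[OF wbar m(1)] unfolding \<epsilon> by linarith
  have h\<sigma>\<gamma>: "2 \<le> h * \<sigma> * (1 - \<gamma>)"
    using h \<sigma> \<gamma> by (simp add: pos_divide_le_eq mult.assoc)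
  have h0: "0 < h"
    using h \<sigma> \<gamma> by (intro less_le_trans[OF _ h] divide_pos_pos mult_pos_pos) auto
  have h\<sigma>: "2 \<le> h * \<sigma>" "h * \<sigma> \<le> h"
  proof -
    have "h * \<sigma> * (1 - \<gamma>) \<le> h * \<sigma> * 1" "h * \<sigma> \<le> h * 1"
      using h0 \<sigma> \<gamma> by (intro mult_left_mono; simp)+
    then show "2 \<le> h * \<sigma>" "h * \<sigma> \<le> h"
      using h\<sigma>\<gamma> by linarith+
  qed
  have t0': "h \<le> t0" "real \<tau> \<le> t0" "0 < t0"
    using t0 h0 by auto
  have \<alpha>01: "0 \<le> \<alpha> t" "\<alpha> t \<le> 1" for t
    using h0 t0' by (auto simp: step)
  have Fil_mono: "sets (Fil s) \<subseteq> sets (Fil t)" if "s \<le> t" for s t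
    using filtration.sets_F_mono[OF filt that] .
  have space_Fil: "space (Fil t) = space M" for t
    using subalg by (simp add: subalgebra_def)
  have Fil_meas_mono: "f \<in> borel_measurable (Fil t)"
    if "f \<in> borel_measurable (Fil s)" "s \<le> t" for f :: "'a \<Rightarrow> real" and s t
    using that measurable_mono[OF order_refl refl Fil_mono, of s t borel] by (auto simp: space_Fil)
  have sub: "finite_measure_subalgebra M (Fil t)" for t
    by unfold_locales (rule subalg)

  \<comment> \<open>Adaptedness of the iterates\<close>
  have x_Suc: "x (Suc t) \<omega> $ j =
      x t \<omega> $ j + of_bool (i t \<omega> = j) * (h / (real t + t0)) * (F (x t \<omega>) $ j - x t \<omega> $ j + w t \<omega>)" for t \<omega> j
    by (auto simp: x_def step Let_def)
  have i_meas: "Measurable.pred (Fil t) (\<lambda>\<omega>. i t \<omega> = j)" for t j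
    using i_adapted[of t] by measurable
  have x_meas: "x t \<in> borel_measurable (Fil t)" for t
  proof (induction t)
    case 0
    then show ?case by (simp add: x_def)
  next
    case (Suc t)
    have [measurable]: "x t \<in> borel_measurable (Fil (Suc t))"
      using Suc measurable_mono[OF order_refl refl Fil_mono[of t "Suc t"], of borel] by (auto simp: space_Fil)
    have [measurable]: "(\<lambda>\<omega>. of_bool (i t \<omega> = j) :: real) \<in> borel_measurable (Fil (Suc t))" for j
      by (rule Fil_meas_mono[of _ t]) (use i_meas in \<open>measurable\<close>)
    note [measurable] = w_meas[of t]
    have "(\<lambda>\<omega>. x (Suc t) \<omega> $ j) \<in> borel_measurable (Fil (Suc t))" for j
      unfolding x_Suc by measurable
    then show ?case
      by (subst borel_measurable_euclidean_space) (auto simp: Basis_vec_def inner_axis)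
  qed

  \<comment> \<open>Conditional update probabilities\<close>
  define ind where "ind j t \<omega> = (of_bool (i t \<omega> = j) :: real)" for j t \<omega>
  have ind_meas: "ind j t \<in> borel_measurable (Fil t)" for j t
    unfolding ind_def[abs_def] using i_meas[of t j] by measurable
  have ind_measM [measurable]: "ind j t \<in> borel_measurable M" for j t
    by (rule measurable_from_subalg[OF subalg ind_meas])
  have w_measM [measurable]: "w t \<in> borel_measurable M" for t
    by (rule measurable_from_subalg[OF subalg w_meas])
  have ind_int: "integrable M (ind j t)" for j t
    by (rule integrable_const_bound[where B = 1]) (auto simp: ind_def)
  define p where "p j t = real_cond_exp M (Fil (t - \<tau>)) (ind j t)" for j t
  \<comment> \<open>Clipping makes the bounds hold at every point instead of almost everywhere.
    Before \<open>\<tau>\<close>, where exploration says nothing, \<open>\<sigma>\<close> is a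
    constant default.\<close>
  define D where "D j t \<omega> = (if t < \<tau> then \<sigma> else min 1 (max \<sigma> (p j t \<omega>)))" for j t \<omega>
  have D_bounds: "\<sigma> \<le> D j t \<omega>" "D j t \<omega> \<le> 1" for j t \<omega>
    using \<sigma> by (auto simp: D_def)
  have p_meas: "p j t \<in> borel_measurable (Fil (t - \<tau>))" for j t
    unfolding p_def by (rule borel_measurable_cond_exp)
  have D_meas: "D j t \<in> borel_measurable (Fil (t - \<tau>))" for j t
    using p_meas[of j t] unfolding D_def[abs_def] by measurable
  have event_sets: "{\<eta> \<in> space M. i t \<eta> = j} \<in> sets M" for t j
    using i_meas[of t j] subalg[of t] by (auto simp: pred_def subalgebra_def)
  have D_eq: "AE \<omega> in M. p j t \<omega> = D j t \<omega>" if "\<tau> \<le> t" for j t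
  proof -
    interpret finite_measure_subalgebra M "Fil (t - \<tau>)" by (rule sub)
    have "AE \<omega> in M. p j t \<omega> = real_cond_exp M (Fil (t - \<tau>)) (indicat_real {\<eta> \<in> space M. i t \<eta> = j}) \<omega>"
      unfolding p_def by (rule real_cond_exp_cong) (use event_sets in \<open>auto simp: ind_def indicator_def\<close>)
    moreover have "AE \<omega> in M. p j t \<omega> \<le> 1"
      unfolding p_def by (rule real_cond_exp_le_c[OF ind_int]) (auto simp: ind_def)
    ultimately show ?thesis
      using exploration[OF that, of j] by eventually_elim (use that in \<open>auto simp: D_def\<close>)
  qed
  have ind_D_centred: "AE \<omega> in M. real_cond_exp M (Fil (t - \<tau>)) (\<lambda>\<omega>. ind j t \<omega> - D j t \<omega>) \<omega> = 0"
    if "\<tau> \<le> t" for j t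
  proof -
    interpret finite_measure_subalgebra M "Fil (t - \<tau>)" by (rule sub)
    have D_int: "integrable M (D j t)"
      using measurable_from_subalg[OF subalg D_meas] D_bounds(2)[of j t]
        order_trans[OF less_imp_le[OF \<sigma>(1)] D_bounds(1)[of j t]]
      by (intro integrable_const_bound[where B = 1]) auto
    show ?thesis
      using real_cond_exp_diff[OF ind_int[of j t] D_int] real_cond_exp_F_meas[OF D_int D_meas] D_eq[OF that, of j]
      by eventually_elim (auto simp: p_def)
  qed

  \<comment> \<open>Boundedness and centring of the innovations\<close>
  define e where "e j t \<omega> = innovation \<tau> (\<lambda>k. x k \<omega>) (\<lambda>k. i k \<omega>) (\<lambda>k. w k \<omega>) (\<lambda>k. D j k \<omega>) j t" for j t \<omega>
  define G where "G j t \<omega> = (F (x t \<omega>) - x t \<omega>) $ j" for j t \<omega>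
  have G_meas: "G j t \<in> borel_measurable (Fil t)" for j t
    unfolding G_def[abs_def] using x_meas[of t] by measurable
  have G_bound: "AE \<omega> in M. \<bar>G j t \<omega>\<bar> \<le> (2 * xbar + C) * v $ j" for j t
    using x_bound[of t] by eventually_elim (simp add: G_def residual_le del: vector_minus_component)
  have e_eq: "e j t \<omega> = (if t < \<tau> then 0 else
      ((ind j t \<omega> - D j t \<omega>) * G j (t - \<tau>) \<omega> + ind j t \<omega> * w t \<omega>) / v $ j)" for j t \<omega>
    by (simp add: e_def innovation_def ind_def G_def)
  have e_meas: "e j t \<in> borel_measurable (Fil (Suc t))" for j t
  proof -
    note [measurable] = w_meas[of t] Fil_meas_mono[OF G_meas[of j "t - \<tau>"], of "Suc t"]
      Fil_meas_mono[OF D_meas[of j t], of "Suc t"] Fil_meas_mono[OF ind_meas[of j t], of "Suc t"]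
    show ?thesis
      unfolding e_eq[abs_def] by measurable
  qed
  have e_bound: "AE \<omega> in M. \<bar>e j t \<omega>\<bar> \<le> \<epsilon>" for j t
    using x_bound[of "t - \<tau>"] w_bound[of t]
  proof eventually_elim
    case (elim \<omega>)
    then show ?case
      unfolding e_def \<epsilon> using xbar0 C D_bounds[of j t \<omega>] \<sigma> by (intro innovation_bound) auto
  qed
  have e_orth: "expectation (\<lambda>\<omega>. e j t \<omega> * Z \<omega>) = 0"
    if Z: "Z \<in> borel_measurable (Fil (t - \<tau>))" "AE \<omega> in M. \<bar>Z \<omega>\<bar> \<le> b" for j t b and Z :: "'a \<Rightarrow> real"
  proof (cases "t < \<tau>")
    case True
    then show ?thesis by (simp add: e_eq)
  next
    case False
    \<comment> \<open>The two halves of the innovation are centred at different times: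
      \<open>ind - D\<close> given \<open>Fil (t - \<tau>)\<close>, and \<open>w t\<close> given
      \<open>Fil t\<close>, where the indicator and \<open>Z\<close> are known.\<close>
    have GZ_meas: "(\<lambda>\<omega>. G j (t - \<tau>) \<omega> * Z \<omega>) \<in> borel_measurable (Fil (t - \<tau>))"
      using G_meas Z(1) by measurable
    have GZ_bound: "AE \<omega> in M. \<bar>G j (t - \<tau>) \<omega> * Z \<omega>\<bar> \<le> (2 * xbar + C) * v $ j * b"
      using G_bound[of j "t - \<tau>"] Z(2)
      by eventually_elim (use xbar0 C less_imp_le[OF v_pos[of j]] in \<open>auto simp: abs_mult intro!: mult_mono\<close>)
    have diff_bound: "AE \<omega> in M. \<bar>ind j t \<omega> - D j t \<omega>\<bar> \<le> 1"
    proof (rule AE_I2)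
      fix \<omega>
      show "\<bar>ind j t \<omega> - D j t \<omega>\<bar> \<le> 1"
        using D_bounds(1)[of j t \<omega>] D_bounds(2)[of j t \<omega>] \<sigma> by (auto simp: ind_def)
    qed
    have diff_meas: "(\<lambda>\<omega>. ind j t \<omega> - D j t \<omega>) \<in> borel_measurable M"
      using measurable_from_subalg[OF subalg D_meas[of j t]] by measurable
    note 1 = expectation_mult_cond_centred[OF subalg GZ_meas GZ_bound diff_meas diff_bound ind_D_centred]
    have iZ_meas: "(\<lambda>\<omega>. ind j t \<omega> * Z \<omega>) \<in> borel_measurable (Fil t)"
      using ind_meas Fil_meas_mono[OF Z(1), of t] by measurable
    have iZ_bound: "AE \<omega> in M. \<bar>ind j t \<omega> * Z \<omega>\<bar> \<le> b"
      using Z(2) by eventually_elim (auto simp: ind_def)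
    note 2 = expectation_mult_cond_centred[OF subalg iZ_meas iZ_bound w_measM w_bound w_mean]
    have "e j t \<omega> * Z \<omega> = (G j (t - \<tau>) \<omega> * Z \<omega> * (ind j t \<omega> - D j t \<omega>) + ind j t \<omega> * Z \<omega> * w t \<omega>) / v $ j" for \<omega>
      using False by (simp add: e_eq algebra_simps)
    then show ?thesis
      using 1 2 False by simp
  qed
  have noise_locale: "lagged_noise M Fil (D j) (e j) \<alpha> \<sigma> \<epsilon> \<tau>" for j
    using subalg Fil_mono \<alpha>01 \<sigma> \<epsilon>0 D_meas D_bounds e_meas e_bound e_orth
    by unfold_locales auto

  \<comment> \<open>Union bound over components and times\<close>
  define L where "L = ln (2 * (real \<tau> + 1) * (real T)\<^sup>2 * real CARD('n) / \<delta>)"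
  define N where "N j t \<omega> = damped (\<lambda>k. \<alpha> k * D j k \<omega>) (\<lambda>k. \<alpha> k * e j k \<omega>) t" for j t \<omega>
  \<comment> \<open>The threshold of \<open>total_noise_tail\<close> with \<open>U\<close> taken
    from \<open>damped_square_steps_le\<close>.\<close>
  define R where "R t = 2 * \<epsilon> * sqrt (real (Suc \<tau>) * L * (2 * h / (\<sigma> * (real t + t0))))" for t
  define Bad where "Bad j t = {\<omega> \<in> space M. R t < \<bar>N j t \<omega>\<bar>}" for j t
  have T1: "1 \<le> real T" using T by simp
  have card1: "1 \<le> real CARD('n)" using zero_less_card_finite[where 'a = 'n] by linarith
  have arg: "1 < 2 * (real \<tau> + 1) * (real T)\<^sup>2 * real CARD('n) / \<delta>"
  proof -
    have "2 * 1 * 1\<^sup>2 * 1 \<le> 2 * (real \<tau> + 1) * (real T)\<^sup>2 * real CARD('n)"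
      using T1 card1 by (intro mult_mono power_mono) auto
    then show ?thesis using \<delta> by (simp add: less_divide_eq)
  qed
  have L0: "0 < L" unfolding L_def using arg by simp
  have expL: "exp (- L) = \<delta> / (2 * (real \<tau> + 1) * (real T)\<^sup>2 * real CARD('n))"
    unfolding L_def using arg by (simp add: exp_minus)

  have N_meas [measurable]: "N j t \<in> borel_measurable M" for j t
    unfolding N_def[abs_def] by (rule lagged_noise.total_noise_measurable[OF noise_locale])
  have Bad_sets [measurable]: "Bad j t \<in> sets M" for j t
    unfolding Bad_def by measurable
  have Bad_prob: "prob (Bad j t) \<le> real (Suc \<tau>) * (2 * exp (- L))" for j t
    unfolding Bad_def R_def N_def
  proof (rule lagged_noise.total_noise_tail[OF noise_locale L0])
    show "0 < 2 * h / (\<sigma> * (real t + t0))"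
      using h0 \<sigma> t0' by (intro divide_pos_pos mult_pos_pos add_nonneg_pos) auto
    show "damped (\<lambda>k. \<alpha> k * \<sigma>) (\<lambda>k. (\<alpha> k)\<^sup>2) t \<le> 2 * h / (\<sigma> * (real t + t0))"
      unfolding step using h\<sigma> t0' \<sigma> by (intro damped_square_steps_le) auto
  qed
  have "prob (\<Union>(j, t)\<in>UNIV \<times> {1..T}. Bad j t) \<le> (\<Sum>(j, t)\<in>UNIV \<times> {1..T}. prob (Bad j t))"
    by (rule order_trans[OF measure_UNION_le]) (auto simp: case_prod_unfold)
  also have "\<dots> \<le> (\<Sum>(j, t)\<in>(UNIV :: 'n set) \<times> {1..T}. real (Suc \<tau>) * (2 * exp (- L)))"
    by (rule sum_mono) (use Bad_prob in auto)
  \<comment> \<open>There are \<open>T * CARD('n)\<close> pairs, and \<open>exp (- L)\<close>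
    contains \<open>T\<close> squared.\<close>
  also have "\<dots> = \<delta> / real T"
  proof -
    have "m * b * (c * (2 * (\<delta> / (2 * c * b\<^sup>2 * m)))) = \<delta> / b" if "0 < b" "0 < c" "0 < m" for b c m :: real
      using that by (simp add: power2_eq_square)
    from this[of "real T" "real \<tau> + 1" "real CARD('n)"] show ?thesis
      using T1 by (simp add: expL card_cartesian_product add.commute)
  qed
  also have "\<dots> \<le> \<delta>"
    using T1 \<delta> by (simp add: divide_le_eq mult_le_cancel_left1)
  finally have Bad_total: "prob (\<Union>(j, t)\<in>UNIV \<times> {1..T}. Bad j t) \<le> \<delta>" .

  \<comment> \<open>Matching the constants\<close>
  define A where "A = 12 * \<epsilon> / (1 - \<gamma>) * sqrt ((real \<tau> + 1) * h / \<sigma>) * sqrt L"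
  define Q where "Q = 4 / (1 - \<gamma>) * max (16 * \<epsilon> * h * real \<tau> / \<sigma>) (2 * xbar * (real \<tau> + t0))"
  \<comment> \<open>The factor 9 is three quarters of 12: \<open>K\<close> equals
    \<open>3 / 4 * (1 - \<gamma>) * A\<close>, the most noise that \<open>decay_step\<close>
    tolerates.\<close>
  define K where "K = 9 * \<epsilon> * sqrt ((real \<tau> + 1) * h / \<sigma>) * sqrt L"
  have K: "0 \<le> K" "K \<le> 3 / 4 * (1 - \<gamma>) * A"
  proof -
    show "0 \<le> K"
      using \<epsilon>0 h0 \<sigma> L0 by (simp add: K_def)
    have "9 * \<epsilon> * b * c \<le> 3 / 4 * g * (12 * \<epsilon> / g * b * c)" if "g \<noteq> 0" for g b c :: real
      using that by simp
    then show "K \<le> 3 / 4 * (1 - \<gamma>) * A"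
      unfolding K_def A_def by this (use \<gamma> in simp)
  qed
  have R_le: "R t \<le> K / sqrt (real t + t0)" for t
  proof -
    have "R t = 2 * \<epsilon> * (sqrt 2 * sqrt ((real \<tau> + 1) * h / \<sigma>) * sqrt L / sqrt (real t + t0))"
      unfolding R_def by (simp add: real_sqrt_mult[symmetric] real_sqrt_divide[symmetric] mult_ac add_ac)
    also have "\<dots> = 2 * sqrt 2 * (\<epsilon> * sqrt ((real \<tau> + 1) * h / \<sigma>) * sqrt L / sqrt (real t + t0))"
      by simp
    also have "\<dots> \<le> 9 * (\<epsilon> * sqrt ((real \<tau> + 1) * h / \<sigma>) * sqrt L / sqrt (real t + t0))"
      using \<epsilon>0 h0 \<sigma> L0 t0' sqrt2_less_2 by (intro mult_right_mono) auto
    finally show ?thesis by (simp add: K_def)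
  qed
  have Q: "8 * \<epsilon> * h * real \<tau> / (\<sigma> * (1 - \<gamma>)) \<le> Q" "2 * xbar * (real \<tau> + t0) \<le> Q"
  proof -
    have "8 * \<epsilon> * h * real \<tau> / (\<sigma> * (1 - \<gamma>)) \<le> 64 * \<epsilon> * h * real \<tau> / (\<sigma> * (1 - \<gamma>))"
      using \<epsilon>0 h0 \<sigma> \<gamma> by (intro divide_right_mono mult_right_mono) auto
    also have "\<dots> = 4 / (1 - \<gamma>) * (16 * \<epsilon> * h * real \<tau> / \<sigma>)"
      by (simp add: mult_ac)
    also have "\<dots> \<le> Q"
      unfolding Q_def using \<gamma> by (intro mult_left_mono) auto
    finally show "8 * \<epsilon> * h * real \<tau> / (\<sigma> * (1 - \<gamma>)) \<le> Q" .
    have "1 * (2 * xbar * (real \<tau> + t0)) \<le> 4 / (1 - \<gamma>) * (2 * xbar * (real \<tau> + t0))"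
      using \<gamma> xbar0 t0' by (intro mult_right_mono) auto
    also have "\<dots> \<le> Q"
      unfolding Q_def using \<gamma> by (intro mult_left_mono) auto
    finally show "2 * xbar * (real \<tau> + t0) \<le> Q" by simp
  qed

  \<comment> \<open>From good paths to probability\<close>
  define S where "S = {\<omega> \<in> space M. weighted_infnorm v (x T \<omega> - xstar) \<le> A / sqrt (real T + t0) + Q / (real T + t0)}"
  have S_sets: "S \<in> sets M"
    unfolding S_def le_iff using measurable_from_subalg[OF subalg x_meas[of T]] by measurable
  \<comment> \<open>The pathwise bound needs its hypotheses at all times at once; countably many
    null sets are discarded.\<close>
  have good: "AE \<omega> in M. (\<forall>t. weighted_infnorm v (x t \<omega>) \<le> xbar) \<and> (\<forall>t. \<bar>w t \<omega>\<bar> \<le> wbar)"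
    using x_bound w_bound by (simp add: AE_all_countable)
  have "AE \<omega> in M. \<omega> \<in> space M - (\<Union>(j, t)\<in>UNIV \<times> {1..T}. Bad j t) \<longrightarrow> \<omega> \<in> S"
    using good
  proof eventually_elim
    case (elim \<omega>)
    show ?case
    proof
      assume \<omega>: "\<omega> \<in> space M - (\<Union>(j, t)\<in>UNIV \<times> {1..T}. Bad j t)"
      have noise: "\<bar>N j t \<omega>\<bar> \<le> K / sqrt (real t + t0)" if "t \<le> T" for t j
      \<comment> \<open>The bad events start at time 1; at time 0 the noise vanishes.\<close>
      proof (cases "t = 0")
        case True
        then show ?thesis using K(1) t0' by (simp add: N_def)
      next
        case False
        then have "(j, t) \<in> UNIV \<times> {1..T}" using that by simp
        then have "\<omega> \<notin> Bad j t" using \<omega> by blast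
        then have "\<bar>N j t \<omega>\<bar> \<le> R t" using \<omega> by (simp add: Bad_def)
        then show ?thesis using R_le[of t] by linarith
      qed
      have "weighted_infnorm v (x T \<omega> - xstar) \<le> A / sqrt (real T + t0) + Q / (real T + t0)"
      proof (rule async_pathwise_bound[where D = "\<lambda>j k. D j k \<omega>" and w = "\<lambda>k. w k \<omega>" and i = "\<lambda>k. i k \<omega>"
            and \<sigma> = \<sigma> and K = K and \<epsilon> = \<epsilon> and xbar = xbar and wbar = wbar and \<tau> = \<tau> and h = h and x = "\<lambda>k. x k \<omega>"])
        show "\<bar>damped (\<lambda>k. h / (real k + t0) * D j k \<omega>)
            (\<lambda>k. h / (real k + t0) * innovation \<tau> (\<lambda>k. x k \<omega>) (\<lambda>k. i k \<omega>) (\<lambda>k. w k \<omega>) (\<lambda>k. D j k \<omega>) j k) t\<bar>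
            \<le> K / sqrt (real t + t0)" if "t \<le> T" for t j
          using noise[OF that, of j] by (simp add: N_def e_def step)
      qed (use x_Suc fixed elim xbar D_bounds \<sigma> h\<sigma>\<gamma> t0' C wbar \<epsilon> Q K in auto)
      then show "\<omega> \<in> S" using \<omega> by (simp add: S_def)
    qed
  qed
  then have "prob (space M - (\<Union>(j, t)\<in>UNIV \<times> {1..T}. Bad j t)) \<le> prob S"
    by (intro finite_measure_mono_AE S_sets) auto
  moreover have "prob (space M - (\<Union>(j, t)\<in>UNIV \<times> {1..T}. Bad j t))
      = 1 - prob (\<Union>(j, t)\<in>UNIV \<times> {1..T}. Bad j t)"
    by (rule prob_compl) auto
  ultimately have "1 - \<delta> \<le> prob S"
    using Bad_total by linarith
  moreover have "A / sqrt (real T + t0) + Q / (real T + t0) =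
      12 * \<epsilon> / (1 - \<gamma>) * sqrt ((real \<tau> + 1) * h / \<sigma>)
          * sqrt (ln (2 * (real \<tau> + 1) * (real T)\<^sup>2 * real CARD('n) / \<delta>) / (real T + t0))
        + 4 / (1 - \<gamma>) * max (16 * \<epsilon> * h * real \<tau> / \<sigma>) (2 * xbar * (real \<tau> + t0))
          * (1 / (real T + t0))"
    unfolding A_def Q_def L_def by (simp add: real_sqrt_divide)
  ultimately show ?thesis
    unfolding S_def by simp
qed

end
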